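(* Let $\lambda\in(0,\tfrac12)$, let $m,n$ be positive integers, $N=mn$, and $\rho\in(0,\infty)$. Let $\theta_{N,\rho}(\tilde\xi^N)$ be the optimal value of the exact compromise decision problem $$\theta_{N,\rho}(\tilde\xi^N)=\min_{x\in X}\ \frac1m\sum_{i=1}^m f_n(x;\tilde\xi^n_i)+\frac{\rho}{2}\Big\|x-\frac1m\sum_{i=1}^m x_n(\tilde\xi^n_i)\Big\|^2,$$ where $x_n(\tilde\xi^n_i)\in\arg\min_{x\in X}f_n(x;\tilde\xi^n_i)$ for $i=1,\dots,m$. Then: 1. $$\mathbb{E}\big[|\theta_{N,\rho}(\tilde\xi^N)-\theta^*|\big]\le \frac{6m-4}{m}R_n(F,\Xi)\le\frac{6m-4}{m\,n^{\lambda}}N_F .$$ 2. $$\mathrm{Var}\big[|\theta_{N,\rho}(\tilde\xi^N)-\theta^*|\big]\le\frac{36M_FN_F}{m\,n^{\lambda}}+\frac{36N_F^2}{n^{2\lambda}} .$$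
   Context: $\tilde\xi$ is a random vector on a probability space with values in $\Xi\subset\mathbb R^d$. $X\subset\mathbb R^p$ is a nonempty compact convex set contained in a cube of edge length $D$. $F:X\times\Xi\to\mathbb R$ is a Carathéodory function (continuous in $x$, measurable in $\xi$) such that: (i) for some $L_F$ and $\gamma\in(0,1]$, $|F(x,\xi)-F(y,\xi)|\le L_F\|x-y\|^\gamma$ for all $x,y\in X$, $\xi\in\Xi$; (ii) for some $M_F\in(0,\infty)$, $\sup_{x\in X,\xi\in\Xi}|F(x,\xi)|<M_F$; (iii) $F(\cdot,\xi)$ is convex on $X$ for every $\xi\in\Xi$. $\|\cdot\|$ is the Euclidean norm. True problem: $f(x)=\mathbb E[F(x,\tilde\xi)]$, $\theta^*=\min_{x\in X}f(x)$. Sampling: $\tilde\xi_1,\dots,\tilde\xi_N$ ($N=mn$) are i.i.d. copies of $\tilde\xi$; $\tilde\xi^N=\{\tilde\xi_1,\dots,\tilde\xi_N\}$, and $\tilde\xi^n_i=\{\tilde\xi_{(i-1)n+1},\dots,\tilde\xi_{in}\}$ is the sample of the $i$-th replication. $f_n(x;\xi^n_i)=\frac1n\sum_{j=1}^nF(x,\xi_{(i-1)n+j})$. Rademacher average: with $\tilde\sigma_1,\dots,\tilde\sigma_n$ i.i.d., $\Pr(\tilde\sigma_i=1)=\Pr(\tilde\sigma_i=-1)=\frac12$, $$R_n(F,\Xi)=\sup_{\xi_1,\dots,\xi_n\in\Xi}\mathbb E_{\tilde\sigma}\Big[\sup_{x\in X}\Big|\frac1n\sum_{i=1}^n\tilde\sigma_iF(x,\xi_i)\Big|\Big].$$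 Constant: $N_F=L_FD^\gamma p^{\gamma/2}+M_F\sqrt{2\log2}+\dfrac{M_Fp^{1/2}}{\sqrt{\gamma(1-2\lambda)e}}$. All selections and random quantities whose expectation or variance is taken are assumed measurable. *)

theory Defs
  imports "HOL-Probability.Probability"
begin

(* Cubes need not be axis-parallel: c + Q x is a rigid motion. *)
definition is_cube :: "real \<Rightarrow> (real ^ 'p) set \<Rightarrow> bool" where
  "is_cube D C \<longleftrightarrow>
     (\<exists>c (Q :: real ^ 'p \<Rightarrow> real ^ 'p).
        orthogonal_transformation Q \<and> C = (\<lambda>x. c + Q x) ` cbox 0 (\<chi> i. D))"

definition argmin_set :: "('a \<Rightarrow> real) \<Rightarrow> 'a set \<Rightarrow> 'a set" where
  "argmin_set g X = {x. is_arg_min g (\<lambda>y. y \<in> X) x}"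

(* The optimal value of min g over X.  It is only used for continuous g on a nonempty compact X,
   where the infimum is attained (opt_value_attained). *)
definition opt_value :: "('a \<Rightarrow> real) \<Rightarrow> 'a set \<Rightarrow> real" where
  "opt_value g X = (INF x\<in>X. g x)"

lemma opt_value_attained:
  fixes g :: "'a::topological_space \<Rightarrow> real"
  assumes "compact X" "X \<noteq> {}" "continuous_on X g"
  shows "\<exists>x\<in>X. g x = opt_value g X \<and> (\<forall>y\<in>X. g x \<le> g y)"
proof -
  obtain x where x: "x \<in> X" "\<forall>y\<in>X. g x \<le> g y"
    using continuous_attains_inf[OF assms] by blast
  have "opt_value g X = g x"
    unfolding opt_value_def using x by (intro cInf_eq_minimum) auto
  with x show ?thesis by auto
qed

definition true_objective ::
  "'w measure \<Rightarrow> ('w \<Rightarrow> 'z) \<Rightarrow> ('x \<Rightarrow> 'z \<Rightarrow> real) \<Rightarrow> 'x \<Rightarrow> real" where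
  "true_objective M \<xi> F x = prob_space.expectation M (\<lambda>\<omega>. F x (\<xi> \<omega>))"

definition saa_objective ::
  "('x \<Rightarrow> 'z \<Rightarrow> real) \<Rightarrow> nat \<Rightarrow> (nat \<Rightarrow> 'z) \<Rightarrow> 'x \<Rightarrow> real" where
  "saa_objective F n z x = (1 / real n) * (\<Sum>j=1..n. F x (z j))"

(* Samples are functions on {1..n}, extended by undefined.  The i-th block (i \<ge> 1) of a sequence
   s indexed from 1 is (s ((i-1)n+1), ..., s (in)). *)
definition replication :: "nat \<Rightarrow> (nat \<Rightarrow> 'z) \<Rightarrow> nat \<Rightarrow> nat \<Rightarrow> 'z" where
  "replication n s i = (\<lambda>j\<in>{1..n}. s ((i - 1) * n + j))"

(* xsel is the selection of SAA minimizers, as a function of a sample of size n. *)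
definition compromise_objective ::
  "(real ^ 'p \<Rightarrow> 'z \<Rightarrow> real) \<Rightarrow> ((nat \<Rightarrow> 'z) \<Rightarrow> real ^ 'p) \<Rightarrow> real \<Rightarrow> nat \<Rightarrow> nat
     \<Rightarrow> (nat \<Rightarrow> 'z) \<Rightarrow> real ^ 'p \<Rightarrow> real" where
  "compromise_objective F xsel \<rho> m n s x =
     (1 / real m) * (\<Sum>i=1..m. saa_objective F n (replication n s i) x)
     + \<rho> / 2 * (norm (x - (1 / real m) *\<^sub>R (\<Sum>i=1..m. xsel (replication n s i))))\<^sup>2"

definition compromise_value ::
  "(real ^ 'p \<Rightarrow> 'z \<Rightarrow> real) \<Rightarrow> (real ^ 'p) set \<Rightarrow> ((nat \<Rightarrow> 'z) \<Rightarrow> real ^ 'p)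
     \<Rightarrow> real \<Rightarrow> nat \<Rightarrow> nat \<Rightarrow> (nat \<Rightarrow> 'z) \<Rightarrow> real" where
  "compromise_value F X xsel \<rho> m n s = opt_value (compromise_objective F xsel \<rho> m n s) X"

(* Law of n independent signs, each +1 or -1 with probability 1/2. *)
definition rademacher_pmf :: "nat \<Rightarrow> (nat \<Rightarrow> real) pmf" where
  "rademacher_pmf n = Pi_pmf {1..n} 0 (\<lambda>_. pmf_of_set {- 1, 1})"

(* Both suprema are over nonempty bounded sets of reals when X and Z are nonempty and F is
   bounded on X \<times> Z. *)
definition rademacher_average ::
  "('x \<Rightarrow> 'z \<Rightarrow> real) \<Rightarrow> 'x set \<Rightarrow> 'z set \<Rightarrow> nat \<Rightarrow> real" where
  "rademacher_average F X Z n =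
     (SUP z \<in> {1..n} \<rightarrow>\<^sub>E Z.
        measure_pmf.expectation (rademacher_pmf n)
          (\<lambda>\<sigma>. SUP x\<in>X. \<bar>(1 / real n) * (\<Sum>i=1..n. \<sigma> i * F x (z i))\<bar>))"

definition N_const :: "real \<Rightarrow> real \<Rightarrow> real \<Rightarrow> real \<Rightarrow> nat \<Rightarrow> real \<Rightarrow> real" where
  "N_const L M D \<gamma> p l =
     L * D powr \<gamma> * real p powr (\<gamma> / 2) + M * sqrt (2 * ln 2)
     + M * real p powr (1 / 2) / sqrt (\<gamma> * (1 - 2 * l) * exp 1)"

end

theory Submission
  imports Defs
begin

text \<open>Let \<open>\<delta>\<^sub>i\<close> be the uniform deviation over X of the sample objective of the i-th replication from the
  true objective.  Evaluating the compromise objective at the mean of the replication solutions, where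
  the penalty vanishes, and using convexity gives
  \<open>\<bar>\<Theta> - \<theta>\<bar> \<le> (3m - 2) / m\<^sup>2 * (\<delta>\<^sub>1 + \<dots> + \<delta>\<^sub>m)\<close>.  Symmetrization gives \<open>E \<delta>\<^sub>i \<le> 2R\<close>, which yields the
  bound on the expectation.  The deviations are independent and at most 2M, so the second moment
  of their sum is at most \<open>m * 4MR + m\<^sup>2 * 4R\<^sup>2\<close>, which yields the bound on the variance.  Finally R is bounded
  by Massart's finite class lemma on a net with \<open>\<nu>^p\<close> points, \<open>\<nu> = \<lfloor>n powr (1 / (2\<gamma>))\<rfloor>\<close>.\<close>

section \<open>Rademacher averages\<close>

text \<open>The upper estimate is the delicate half, because the compromise minimizer optimizes no
  single replication. The penalty vanishes at the test point and is dropped in the lower estimate,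
  so no bound depends on \<open>\<rho>\<close>. Convexity replaces the mean by the replication
  solutions, and the i-th objective must then be evaluated at the j-th solution. A pair with i
  different from j costs one deviation of i and two of j, a pair with i = j only one, so the m^2
  pairs cost 3m - 2 times the sum of the deviations. In the second moment the diagonal is linear in
  R, since a deviation d in [0, 2M] satisfies d^2 <= 2M d; independence makes the rest quadratic in
  R. The prefactor (3/m)^2 turns both coefficients 4 into 36. The exponent in \<open>\<nu>\<close>
  makes the net error of order n^(-1/2). The price is a logarithm of n in the finite class bound;
  weakening the rate to n^(-l) with l < 1/2 absorbs it and creates the last term of
  \<open>N_const\<close>.\<close>

lemma cosh_le_exp_half_square: "cosh x \<le> exp (x\<^sup>2 / 2)" for x :: real
proof -
  have *: "cosh y \<le> exp (y\<^sup>2 / 2)" if "0 \<le> y" for y :: real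
  proof -
    \<comment> \<open>This is the function bounded in Hoeffding's lemma, for success probability 1/2
      and argument 2y. That bound wants a nonnegative argument; evenness of both sides does the
      rest.\<close>
    have "- y + ln (cosh y * exp y) = - (2 * y) * (1 / 2) + ln (1 + 1 / 2 * (exp (2 * y) - 1))"
      by (simp add: cosh_def field_simps mult_exp_exp)
    also have "\<dots> \<le> (2 * y)\<^sup>2 / 8"
      using that by (intro Hoeffdings_lemma_aux) auto
    finally have "ln (cosh y) \<le> y\<^sup>2 / 2"
      by (simp add: ln_mult power_mult_distrib)
    then show ?thesis
      by (metis cosh_real_pos exp_le_cancel_iff exp_ln)
  qed
  show ?thesis
    using *[of x] *[of "- x"] by (cases "0 \<le> x") auto
qed

lemma finite_set_rademacher_pmf: "finite (set_pmf (rademacher_pmf n))"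
  unfolding rademacher_pmf_def by (auto simp: set_Pi_pmf intro!: finite_PiE_dflt)

lemma rademacher_pmf_range:
  assumes "\<sigma> \<in> set_pmf (rademacher_pmf n)" "i \<in> {1..n}"
  shows "\<sigma> i = 1 \<or> \<sigma> i = - 1"
  using assms unfolding rademacher_pmf_def by (auto simp: set_Pi_pmf PiE_dflt_def)

lemma integrable_rademacher_pmf [simp]:
  "integrable (measure_pmf (rademacher_pmf n)) (f :: _ \<Rightarrow> real)"
  by (intro integrable_measure_pmf_finite finite_set_rademacher_pmf)

text \<open>Independence of the signs factors the moment generating function into hyperbolic
  cosines: the signed average is subgaussian with variance proxy B^2/n.\<close>

lemma rademacher_mgf_le:
  fixes a :: "nat \<Rightarrow> real"
  assumes "0 < n" and a: "\<And>i. i \<in> {1..n} \<Longrightarrow> \<bar>a i\<bar> \<le> B"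
  shows "measure_pmf.expectation (rademacher_pmf n) (\<lambda>\<sigma>. exp (s * ((1 / real n) * (\<Sum>i=1..n. \<sigma> i * a i))))
           \<le> exp (s\<^sup>2 * B\<^sup>2 / (2 * real n))"
proof -
  have "measure_pmf.expectation (rademacher_pmf n) (\<lambda>\<sigma>. exp (s * ((1 / real n) * (\<Sum>i=1..n. \<sigma> i * a i))))
      = measure_pmf.expectation (rademacher_pmf n) (\<lambda>\<sigma>. \<Prod>i\<in>{1..n}. exp (s / n * a i * \<sigma> i))"
    by (simp add: exp_sum sum_distrib_left mult_ac)
  also have "\<dots> = (\<Prod>i\<in>{1..n}. measure_pmf.expectation (pmf_of_set {- 1, 1}) (\<lambda>v. exp (s / n * a i * v)))"
    unfolding rademacher_pmf_def
    by (intro expectation_prod_Pi_pmf) (auto intro!: integrable_measure_pmf_finite)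
  also have "\<dots> = (\<Prod>i\<in>{1..n}. cosh (s / n * a i))"
    by (intro prod.cong refl) (simp add: integral_pmf_of_set cosh_def field_simps)
  also have "\<dots> \<le> (\<Prod>i\<in>{1..n}. exp ((s / n * B)\<^sup>2 / 2))"
  proof (intro prod_mono conjI)
    fix i assume i: "i \<in> {1..n}"
    have "(s / n * a i)\<^sup>2 \<le> (s / n * B)\<^sup>2"
      unfolding power_mult_distrib
      using power_mono[OF a[OF i], of 2] by (intro mult_left_mono) auto
    then show "cosh (s / n * a i) \<le> exp ((s / n * B)\<^sup>2 / 2)"
      by (intro order.trans[OF cosh_le_exp_half_square]) auto
  qed auto
  also have "\<dots> = exp (s\<^sup>2 * B\<^sup>2 / (2 * real n))"
    using \<open>0 < n\<close> by (simp add: exp_of_nat_mult[symmetric] field_simps power2_eq_square)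
  finally show ?thesis .
qed

text \<open>The exponential of s times the maximum is at most a sum of exponentials over the class.
  An absolute value is the larger of a form and its negative, which doubles the class and explains
  the factor 2 inside the logarithm.\<close>

lemma rademacher_finite_class_le:
  fixes a :: "'t \<Rightarrow> nat \<Rightarrow> real"
  assumes n: "0 < n" and B: "0 < B" and T: "finite T" "T \<noteq> {}"
    and a: "\<And>t i. t \<in> T \<Longrightarrow> i \<in> {1..n} \<Longrightarrow> \<bar>a t i\<bar> \<le> B"
  shows "measure_pmf.expectation (rademacher_pmf n)
           (\<lambda>\<sigma>. Max ((\<lambda>t. \<bar>(1 / real n) * (\<Sum>i=1..n. \<sigma> i * a t i)\<bar>) ` T))
         \<le> B * sqrt (2 * ln (2 * real (card T)) / real n)"
proof -
  let ?E = "measure_pmf.expectation (rademacher_pmf n)"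
  let ?S = "\<lambda>\<sigma> t. (1 / real n) * (\<Sum>i=1..n. \<sigma> i * a t i)"
  let ?Mx = "\<lambda>\<sigma>. Max ((\<lambda>t. \<bar>?S \<sigma> t\<bar>) ` T)"
  define K where "K = 2 * real (card T)"
  have K: "2 \<le> K"
    using T by (simp add: K_def card_gt_0_iff Suc_leI)
  \<comment> \<open>This s minimizes ln K / s + s B^2 / (2n), the bound c / s reached at the end;
    both summands are then equal.\<close>
  define s where "s = sqrt (2 * real n * ln K) / B"
  have s: "0 < s" using n B K by (simp add: s_def)
  define c where "c = ln K + s\<^sup>2 * B\<^sup>2 / (2 * real n)"
  have exp_c: "exp c = K * exp (s\<^sup>2 * B\<^sup>2 / (2 * real n))"
    using K by (simp add: c_def exp_add)
  have exp_Mx: "exp (s * ?Mx \<sigma>) \<le> (\<Sum>t\<in>T. exp (s * ?S \<sigma> t) + exp (- s * ?S \<sigma> t))" for \<sigma>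
  proof -
    obtain t where t: "t \<in> T" "?Mx \<sigma> = \<bar>?S \<sigma> t\<bar>"
      using Max_in[of "(\<lambda>t. \<bar>?S \<sigma> t\<bar>) ` T"] T by blast
    have "exp (s * ?Mx \<sigma>) \<le> exp (s * ?S \<sigma> t) + exp (- s * ?S \<sigma> t)"
      unfolding t(2) by (simp add: abs_if add_increasing add_increasing2)
    also have "\<dots> \<le> (\<Sum>t\<in>T. exp (s * ?S \<sigma> t) + exp (- s * ?S \<sigma> t))"
      using T t(1) by (intro member_le_sum) auto
    finally show ?thesis .
  qed
  \<comment> \<open>The tangent of exp at c replaces Jensen's inequality.\<close>
  have tangent: "s * ?Mx \<sigma> \<le> c - 1 + exp (s * ?Mx \<sigma>) / exp c" for \<sigma>
    using exp_ge_add_one_self[of "s * ?Mx \<sigma> - c"] by (simp add: exp_diff)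
  have "?E (\<lambda>\<sigma>. exp (s * ?Mx \<sigma>))
      \<le> ?E (\<lambda>\<sigma>. \<Sum>t\<in>T. exp (s * ?S \<sigma> t) + exp (- s * ?S \<sigma> t))"
    by (intro integral_mono exp_Mx) auto
  also have "\<dots> = (\<Sum>t\<in>T. ?E (\<lambda>\<sigma>. exp (s * ?S \<sigma> t)) + ?E (\<lambda>\<sigma>. exp (- s * ?S \<sigma> t)))"
    by simp
  also have "\<dots> \<le> (\<Sum>t\<in>T. exp (s\<^sup>2 * B\<^sup>2 / (2 * real n)) + exp ((- s)\<^sup>2 * B\<^sup>2 / (2 * real n)))"
    by (intro sum_mono add_mono rademacher_mgf_le n a) auto
  also have "\<dots> = exp c"
    by (simp add: exp_c K_def)
  finally have mgf: "?E (\<lambda>\<sigma>. exp (s * ?Mx \<sigma>)) \<le> exp c" .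
  have "s * ?E ?Mx = ?E (\<lambda>\<sigma>. s * ?Mx \<sigma>)" by simp
  also have "\<dots> \<le> ?E (\<lambda>\<sigma>. c - 1 + exp (s * ?Mx \<sigma>) / exp c)"
    by (intro integral_mono tangent) auto
  also have "\<dots> = c - 1 + ?E (\<lambda>\<sigma>. exp (s * ?Mx \<sigma>)) / exp c"
    by (simp add: measure_pmf.prob_space)
  also have "\<dots> \<le> c" using mgf by (simp add: field_simps)
  finally have le: "?E ?Mx \<le> c / s" using s by (simp add: field_simps)
  have ss: "s\<^sup>2 * B\<^sup>2 = 2 * real n * ln K"
    using n B K by (simp add: s_def power_divide)
  have "c = 2 * ln K" using n ss by (simp add: c_def)
  also have "\<dots> = B * sqrt (2 * ln K / real n) * s"
  proof -
    have "sqrt (2 * ln K / real n) * sqrt (2 * real n * ln K) = sqrt ((2 * ln K)\<^sup>2)"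
      using n by (simp add: real_sqrt_mult[symmetric] power2_eq_square)
    also have "\<dots> = 2 * ln K" using K by (subst real_sqrt_abs) simp
    finally show ?thesis using B by (simp add: s_def)
  qed
  finally show ?thesis using le s by (simp add: K_def)
qed

section \<open>Nets of a cube and the resulting rate in n\<close>

lemma interval_grid_centre:
  fixes u D :: real
  assumes "0 \<le> u" "u \<le> D" "0 < \<nu>"
  shows "\<exists>k<\<nu>. \<bar>u - (real k + 1 / 2) * D / real \<nu>\<bar> \<le> D / (2 * real \<nu>)"
proof (cases "u = D")
  \<comment> \<open>The right end point lies in none of the half-open cells and is assigned to the
    last one. The degenerate interval D = 0 falls under this case too, so the other case may divide
    by D.\<close>
  case True
  have "D - (real (\<nu> - 1) + 1 / 2) * D / real \<nu> = D / (2 * real \<nu>)"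
    using \<open>0 < \<nu>\<close> by (simp add: of_nat_diff field_simps)
  then show ?thesis using True assms by (intro exI[of _ "\<nu> - 1"]) auto
next
  case False
  then have D: "0 < D" "u < D" using assms by auto
  define k where "k = nat \<lfloor>u * real \<nu> / D\<rfloor>"
  have nonneg: "0 \<le> u * real \<nu> / D" using assms D by simp
  have k: "real k \<le> u * real \<nu> / D" "u * real \<nu> / D < real k + 1"
    unfolding k_def using nonneg by linarith+
  have "u * real \<nu> / D < real \<nu>" using D \<open>0 < \<nu>\<close> by (simp add: field_simps)
  then have "k < \<nu>" using k by linarith
  moreover have "\<bar>u * real \<nu> / D - (real k + 1 / 2)\<bar> * (D / real \<nu>) \<le> 1 / 2 * (D / real \<nu>)"
    using D by (intro mult_right_mono) (use k in linarith, simp)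
  moreover have "\<bar>u * real \<nu> / D - (real k + 1 / 2)\<bar> * (D / real \<nu>) = \<bar>u - (real k + 1 / 2) * D / real \<nu>\<bar>"
  proof -
    have "u - (real k + 1 / 2) * D / real \<nu> = (u * real \<nu> / D - (real k + 1 / 2)) * (D / real \<nu>)"
      using D \<open>0 < \<nu>\<close> by (simp add: field_simps)
    then show ?thesis using D by (simp add: abs_mult)
  qed
  ultimately show ?thesis by auto
qed

lemma norm_vec_le_sqrt:
  fixes x :: "real ^ 'p"
  assumes "\<And>i. \<bar>x $ i\<bar> \<le> b"
  shows "norm x \<le> sqrt (real CARD('p)) * b"
proof -
  have "0 \<le> b" using assms[of undefined] by linarith
  have "norm x = sqrt (\<Sum>i\<in>UNIV. (x $ i)\<^sup>2)"
    by (simp add: norm_vec_def L2_set_def)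
  also have "\<dots> \<le> sqrt (\<Sum>i\<in>(UNIV :: 'p set). b\<^sup>2)"
  proof (intro real_sqrt_le_mono sum_mono)
    fix i show "(x $ i)\<^sup>2 \<le> b\<^sup>2" using power_mono[OF assms[of i], of 2] by simp
  qed
  also have "\<dots> = sqrt (real CARD('p)) * b"
    using \<open>0 \<le> b\<close> by (simp add: real_sqrt_mult)
  finally show ?thesis .
qed

text \<open>Projecting the cell centres to the convex set, instead of choosing a point of the set in each
  cell, keeps the radius at half the cell diameter.\<close>
lemma cube_net:
  fixes X C :: "(real ^ 'p) set"
  assumes X: "X \<noteq> {}" "closed X" "convex X" and cube: "is_cube D C" "X \<subseteq> C" and \<nu>: "0 < \<nu>"
  obtains T where "finite T" "T \<noteq> {}" "T \<subseteq> X" "card T \<le> \<nu> ^ CARD('p)"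
    "\<And>x. x \<in> X \<Longrightarrow> \<exists>t\<in>T. norm (x - t) \<le> D * sqrt (real CARD('p)) / (2 * real \<nu>)"
proof -
  obtain c and Q :: "real ^ 'p \<Rightarrow> real ^ 'p" where Q: "orthogonal_transformation Q"
    and C: "C = (\<lambda>x. c + Q x) ` cbox 0 (\<chi> i. D)"
    using cube(1) unfolding is_cube_def by auto
  define ctr :: "('p \<Rightarrow> nat) \<Rightarrow> real ^ 'p" where "ctr k = (\<chi> i. (real (k i) + 1 / 2) * D / real \<nu>)" for k
  define G where "G = (UNIV :: 'p set) \<rightarrow>\<^sub>E {..<\<nu>}"
  define T where "T = (\<lambda>k. closest_point X (c + Q (ctr k))) ` G"
  have fin: "finite G" unfolding G_def by (intro finite_PiE) auto
  have "G \<noteq> {}" unfolding G_def using \<nu> by (auto simp: PiE_eq_empty_iff)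
  moreover have "T \<subseteq> X" unfolding T_def using closest_point_in_set[OF X(2,1)] by auto
  moreover have "card T \<le> \<nu> ^ CARD('p)"
    unfolding T_def by (rule order.trans[OF card_image_le[OF fin]]) (simp add: G_def card_funcsetE)
  moreover have "\<exists>t\<in>T. norm (x - t) \<le> D * sqrt (real CARD('p)) / (2 * real \<nu>)" if x: "x \<in> X" for x
  proof -
    obtain u where u: "u \<in> cbox 0 (\<chi> i. D)" "x = c + Q u" using x cube(2) C by auto
    have "\<forall>i. \<exists>k<\<nu>. \<bar>u $ i - (real k + 1 / 2) * D / real \<nu>\<bar> \<le> D / (2 * real \<nu>)"
      using u(1) \<nu> by (intro allI interval_grid_centre) (auto simp: mem_box_cart)
    then obtain k where k: "\<And>i. k i < \<nu>" "\<And>i. \<bar>u $ i - (real (k i) + 1 / 2) * D / real \<nu>\<bar> \<le> D / (2 * real \<nu>)"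
      by metis
    have "k \<in> G" using k(1) by (auto simp: G_def)
    then have "closest_point X (c + Q (ctr k)) \<in> T" by (auto simp: T_def)
    moreover have "norm (x - closest_point X (c + Q (ctr k))) \<le> D * sqrt (real CARD('p)) / (2 * real \<nu>)"
    proof -
      have "norm (x - closest_point X (c + Q (ctr k))) = dist (closest_point X x) (closest_point X (c + Q (ctr k)))"
        using x by (simp add: closest_point_self dist_norm)
      also have "\<dots> \<le> dist x (c + Q (ctr k))"
        by (rule closest_point_lipschitz[OF X(3,2,1)])
      also have "\<dots> = norm (u - ctr k)"
        using Q u(2) by (simp add: dist_norm orthogonal_transformation_norm
            orthogonal_transformation_linear linear_diff[symmetric])
      also have "\<dots> \<le> sqrt (real CARD('p)) * (D / (2 * real \<nu>))"
        using k(2) by (intro norm_vec_le_sqrt) (simp add: ctr_def)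
      finally show ?thesis by (simp add: mult_ac)
    qed
    ultimately show ?thesis by auto
  qed
  moreover have "finite T" using fin by (simp add: T_def)
  moreover have "T \<noteq> {}" using \<open>G \<noteq> {}\<close> by (simp add: T_def)
  ultimately show ?thesis using that by blast
qed

text \<open>The quotient of ln y and y^b has its maximum 1/(b e) at y = e^(1/b); the inequality ln t
  <= t - 1 at t = y^b / e proves it. This is the source of the e in \<open>N_const\<close>.\<close>

lemma ln_le_powr_div_exp:
  assumes "0 < b" "0 < (y::real)"
  shows "ln y \<le> y powr b / (b * exp 1)"
proof -
  have "ln (y powr b / exp 1) \<le> y powr b / exp 1 - 1"
    using assms by (intro ln_le_minus_one) auto
  then have "b * ln y \<le> y powr b / exp 1"
    using assms by (simp add: ln_div ln_powr)
  then show ?thesis using assms by (simp add: field_simps)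
qed

text \<open>Discretization at a single scale: replacing x by a net point changes every
  \<open>F x (z i)\<close> by at most the Hoelder bound at the net radius, and averaging with signs
  of modulus one does not enlarge this. The fineness \<open>\<nu>\<close> stays free so that it can
  be balanced against n later.\<close>

lemma rademacher_sup_le_net:
  fixes F :: "real ^ 'p \<Rightarrow> 'z \<Rightarrow> real"
  assumes X: "X \<noteq> {}" "closed X" "convex X" and cube: "is_cube D C" "X \<subseteq> C"
    and \<gamma>: "0 < \<gamma>" and L: "0 \<le> L"
    and Hoelder: "\<And>x y i. x \<in> X \<Longrightarrow> y \<in> X \<Longrightarrow> i \<in> {1..n} \<Longrightarrow>
                    \<bar>F x (z i) - F y (z i)\<bar> \<le> L * norm (x - y) powr \<gamma>"
    and bound: "\<And>x i. x \<in> X \<Longrightarrow> i \<in> {1..n} \<Longrightarrow> \<bar>F x (z i)\<bar> \<le> B"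
    and B: "0 < B" and n: "0 < n" and \<nu>: "0 < \<nu>"
  shows "measure_pmf.expectation (rademacher_pmf n)
          (\<lambda>\<sigma>. SUP x\<in>X. \<bar>(1 / real n) * (\<Sum>i=1..n. \<sigma> i * F x (z i))\<bar>)
        \<le> L * (D * sqrt (real CARD('p)) / (2 * real \<nu>)) powr \<gamma>
          + B * sqrt (2 * ln (2 * real \<nu> ^ CARD('p)) / real n)"
proof -
  obtain T where T: "finite T" "T \<noteq> {}" "T \<subseteq> X" "card T \<le> \<nu> ^ CARD('p)"
    and net: "\<And>x. x \<in> X \<Longrightarrow> \<exists>t\<in>T. norm (x - t) \<le> D * sqrt (real CARD('p)) / (2 * real \<nu>)"
    using cube_net[OF X cube \<nu>] by metis
  let ?S = "\<lambda>\<sigma> x. (1 / real n) * (\<Sum>i=1..n. \<sigma> i * F x (z i))"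
  let ?\<epsilon> = "L * (D * sqrt (real CARD('p)) / (2 * real \<nu>)) powr \<gamma>"
  have "measure_pmf.expectation (rademacher_pmf n) (\<lambda>\<sigma>. SUP x\<in>X. \<bar>?S \<sigma> x\<bar>)
      \<le> measure_pmf.expectation (rademacher_pmf n) (\<lambda>\<sigma>. ?\<epsilon> + Max ((\<lambda>t. \<bar>?S \<sigma> t\<bar>) ` T))"
  proof (intro integral_mono_AE AE_pmfI cSUP_least)
    fix \<sigma> x assume \<sigma>: "\<sigma> \<in> set_pmf (rademacher_pmf n)" and x: "x \<in> X"
    obtain t where t: "t \<in> T" "norm (x - t) \<le> D * sqrt (real CARD('p)) / (2 * real \<nu>)"
      using net[OF x] by auto
    have "\<bar>?S \<sigma> x - ?S \<sigma> t\<bar> = 1 / real n * \<bar>\<Sum>i=1..n. \<sigma> i * (F x (z i) - F t (z i))\<bar>"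
      by (simp add: right_diff_distrib sum_subtractf diff_divide_distrib[symmetric])
    also have "\<dots> \<le> 1 / real n * (\<Sum>i=1..n. \<bar>\<sigma> i * (F x (z i) - F t (z i))\<bar>)"
      by (intro mult_left_mono sum_abs) auto
    also have "\<dots> \<le> 1 / real n * (\<Sum>i=1..n. ?\<epsilon>)"
    proof (intro mult_left_mono sum_mono)
      fix i assume i: "i \<in> {1..n}"
      have "\<bar>\<sigma> i * (F x (z i) - F t (z i))\<bar> = \<bar>F x (z i) - F t (z i)\<bar>"
        using rademacher_pmf_range[OF \<sigma> i] by auto
      also have "\<dots> \<le> L * norm (x - t) powr \<gamma>"
        using x t(1) T(3) i by (intro Hoelder) auto
      also have "\<dots> \<le> ?\<epsilon>"
        using L \<gamma> t(2) by (intro mult_left_mono powr_mono2) auto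
      finally show "\<bar>\<sigma> i * (F x (z i) - F t (z i))\<bar> \<le> ?\<epsilon>" .
    qed auto
    also have "\<dots> = ?\<epsilon>" using n by simp
    finally have "\<bar>?S \<sigma> x\<bar> \<le> ?\<epsilon> + \<bar>?S \<sigma> t\<bar>" by linarith
    also have "\<bar>?S \<sigma> t\<bar> \<le> Max ((\<lambda>t. \<bar>?S \<sigma> t\<bar>) ` T)"
      using T t(1) by (intro Max_ge) auto
    finally show "\<bar>?S \<sigma> x\<bar> \<le> ?\<epsilon> + Max ((\<lambda>t. \<bar>?S \<sigma> t\<bar>) ` T)" by simp
  qed (use X in auto)
  also have "\<dots> = ?\<epsilon> + measure_pmf.expectation (rademacher_pmf n) (\<lambda>\<sigma>. Max ((\<lambda>t. \<bar>?S \<sigma> t\<bar>) ` T))"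
    by (simp add: measure_pmf.prob_space)
  also have "\<dots> \<le> ?\<epsilon> + B * sqrt (2 * ln (2 * real (card T)) / real n)"
    using T bound by (intro add_left_mono rademacher_finite_class_le n B) auto
  also have "\<dots> \<le> ?\<epsilon> + B * sqrt (2 * ln (2 * real \<nu> ^ CARD('p)) / real n)"
  proof -
    have "0 < card T" using T by (simp add: card_gt_0_iff)
    moreover have "real (card T) \<le> real \<nu> ^ CARD('p)"
      using T(4) by (metis of_nat_le_iff of_nat_power)
    ultimately have "ln (2 * real (card T)) \<le> ln (2 * real \<nu> ^ CARD('p))"
      by (intro ln_mono) auto
    then show ?thesis
      using B n by (intro add_left_mono mult_left_mono real_sqrt_le_mono divide_right_mono) auto
  qed
  finally show ?thesis .
qed

text \<open>The three terms of \<open>N_const\<close> come from the net error, from the factor 2 in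
  the logarithm of the finite class bound, and from ln \<open>\<nu>^p\<close> = p ln
  \<open>\<nu>\<close>.\<close>

lemma rademacher_average_le_N_const:
  fixes F :: "real ^ 'p \<Rightarrow> 'z \<Rightarrow> real"
  assumes X: "X \<noteq> {}" "closed X" "convex X" and cube: "is_cube D C" "X \<subseteq> C"
    and \<gamma>: "0 < \<gamma>" and L: "0 \<le> L"
    and Hoelder: "\<And>x y z. x \<in> X \<Longrightarrow> y \<in> X \<Longrightarrow> z \<in> Z \<Longrightarrow> \<bar>F x z - F y z\<bar> \<le> L * norm (x - y) powr \<gamma>"
    and bound: "\<And>x z. x \<in> X \<Longrightarrow> z \<in> Z \<Longrightarrow> \<bar>F x z\<bar> \<le> B"
    and B: "0 < B" and n: "0 < n" and l: "0 < l" "l < 1 / 2" and Z: "Z \<noteq> {}"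
  shows "rademacher_average F X Z n \<le> N_const L B D \<gamma> CARD('p) l / real n powr l"
proof -
  let ?p = "real CARD('p)"
  define t where "t = real n powr (1 / (2 * \<gamma>))"
  define \<nu> where "\<nu> = nat \<lfloor>t\<rfloor>"
  have t: "1 \<le> t" unfolding t_def using n \<gamma> by (intro ge_one_powr_ge_zero) auto
  then have \<nu>: "1 \<le> real \<nu>" "real \<nu> \<le> t" "t < real \<nu> + 1"
    unfolding \<nu>_def by (simp_all add: le_nat_iff)
  then have \<nu>0: "0 < \<nu>" by simp
  have "0 \<le> D"
  \<comment> \<open>The cube contains the nonempty X, and a box with negative edge length would be
    empty.\<close>
  proof -
    obtain u :: "real ^ 'p" where "u \<in> cbox 0 (\<chi> i. D)"
      using X(1) cube unfolding is_cube_def by auto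
    then show ?thesis by (auto simp: mem_box_cart intro: order.trans)
  qed
  have n1: "1 \<le> real n" using n by simp
  \<comment> \<open>Rounding down loses at most a factor 2, which the 2 in the denominator of the
    net radius compensates; hence the first term of \<open>N_const\<close> carries no extra
    constant.\<close>
  have "t \<le> 2 * real \<nu>" using \<nu> by linarith
  have "(D * sqrt ?p / (2 * real \<nu>)) powr \<gamma> \<le> (D * sqrt ?p / t) powr \<gamma>"
    using \<gamma> \<nu>0 t \<open>0 \<le> D\<close> \<open>t \<le> 2 * real \<nu>\<close>
    by (intro powr_mono2 divide_left_mono) auto
  also have "\<dots> = D powr \<gamma> * ?p powr (\<gamma> / 2) / real n powr (1 / 2)"
    using \<gamma> t \<open>0 \<le> D\<close> n by (simp add: powr_divide powr_mult powr_half_sqrt[symmetric] powr_powr t_def)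
  also have "\<dots> \<le> D powr \<gamma> * ?p powr (\<gamma> / 2) / real n powr l"
    using n n1 l by (intro divide_left_mono powr_mono) auto
  finally have term1: "L * (D * sqrt ?p / (2 * real \<nu>)) powr \<gamma> \<le> L * D powr \<gamma> * ?p powr (\<gamma> / 2) / real n powr l"
    using mult_left_mono[OF _ L] by fastforce
  have npow: "real n powr (1 - 2 * l) / real n = (1 / real n powr l)\<^sup>2"
    using n by (simp add: powr_diff power_divide powr_realpow[symmetric] powr_powr mult.commute)
  have "2 * ln (2 * real \<nu> ^ CARD('p)) / real n = 2 * ln 2 / real n + 2 * ?p * ln (real \<nu>) / real n"
    using \<nu>0 by (simp add: ln_mult ln_realpow add_divide_distrib distrib_left)
  also have "\<dots> \<le> 2 * ln 2 / (real n powr l)\<^sup>2 + ?p / (\<gamma> * (1 - 2 * l) * exp 1) * (1 / real n powr l)\<^sup>2"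
  proof (intro add_mono)
    have "(real n powr l)\<^sup>2 = real n powr (2 * l)"
      using n by (simp add: powr_realpow[symmetric] powr_powr mult.commute)
    also have "\<dots> \<le> real n powr 1"
      using n1 l by (intro powr_mono) auto
    finally show "2 * ln 2 / real n \<le> 2 * ln 2 / (real n powr l)\<^sup>2"
      using n by (intro divide_left_mono) auto
    have "ln (real \<nu>) \<le> ln t" using \<nu> by simp
    also have "\<dots> = ln (real n) / (2 * \<gamma>)" using n by (simp add: t_def ln_powr)
    \<comment> \<open>The exponent b = 1 - 2l is chosen so that, after division by n, exactly the
      square of n^(-l) remains under the root.\<close>
    also have "\<dots> \<le> real n powr (1 - 2 * l) / ((1 - 2 * l) * exp 1) / (2 * \<gamma>)"
      using n l \<gamma> by (intro divide_right_mono ln_le_powr_div_exp) auto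
    finally have "2 * ?p * ln (real \<nu>) / real n
        \<le> 2 * ?p * (real n powr (1 - 2 * l) / ((1 - 2 * l) * exp 1) / (2 * \<gamma>)) / real n"
      by (intro divide_right_mono mult_left_mono) auto
    also have "\<dots> = ?p / (\<gamma> * (1 - 2 * l) * exp 1) * (real n powr (1 - 2 * l) / real n)"
      using \<gamma> l n by (simp add: field_simps)
    finally show "2 * ?p * ln (real \<nu>) / real n \<le> ?p / (\<gamma> * (1 - 2 * l) * exp 1) * (1 / real n powr l)\<^sup>2"
      unfolding npow .
  qed
  finally have "sqrt (2 * ln (2 * real \<nu> ^ CARD('p)) / real n)
      \<le> sqrt (2 * ln 2 / (real n powr l)\<^sup>2 + ?p / (\<gamma> * (1 - 2 * l) * exp 1) * (1 / real n powr l)\<^sup>2)"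
    by (rule real_sqrt_le_mono)
  \<comment> \<open>Subadditivity of the root separates the last two summands of
    \<open>N_const\<close>.\<close>
  also have "\<dots> \<le> sqrt (2 * ln 2 / (real n powr l)\<^sup>2) + sqrt (?p / (\<gamma> * (1 - 2 * l) * exp 1) * (1 / real n powr l)\<^sup>2)"
    using \<gamma> l by (intro sqrt_add_le_add_sqrt) auto
  also have "\<dots> = (sqrt (2 * ln 2) + ?p powr (1 / 2) / sqrt (\<gamma> * (1 - 2 * l) * exp 1)) / real n powr l"
    by (simp add: real_sqrt_mult real_sqrt_divide powr_half_sqrt add_divide_distrib)
  finally have term2: "B * sqrt (2 * ln (2 * real \<nu> ^ CARD('p)) / real n)
      \<le> B * ((sqrt (2 * ln 2) + ?p powr (1 / 2) / sqrt (\<gamma> * (1 - 2 * l) * exp 1)) / real n powr l)"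
    using B by (intro mult_left_mono) auto
  have sum_eq: "L * D powr \<gamma> * ?p powr (\<gamma> / 2) / real n powr l
      + B * ((sqrt (2 * ln 2) + ?p powr (1 / 2) / sqrt (\<gamma> * (1 - 2 * l) * exp 1)) / real n powr l)
      = N_const L B D \<gamma> CARD('p) l / real n powr l"
    by (simp add: N_const_def add_divide_distrib distrib_left)
  show ?thesis
    unfolding rademacher_average_def
  proof (rule cSUP_least)
    show "{1..n} \<rightarrow>\<^sub>E Z \<noteq> {}" using Z by (auto simp: PiE_eq_empty_iff)
  next
    fix z assume z: "z \<in> {1..n} \<rightarrow>\<^sub>E Z"
    have "measure_pmf.expectation (rademacher_pmf n)
          (\<lambda>\<sigma>. SUP x\<in>X. \<bar>(1 / real n) * (\<Sum>i=1..n. \<sigma> i * F x (z i))\<bar>)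
        \<le> L * (D * sqrt ?p / (2 * real \<nu>)) powr \<gamma> + B * sqrt (2 * ln (2 * real \<nu> ^ CARD('p)) / real n)"
      using z by (intro rademacher_sup_le_net[OF X cube \<gamma> L _ _ B n \<nu>0] Hoelder bound) auto
    also have "\<dots> \<le> N_const L B D \<gamma> CARD('p) l / real n powr l"
      using term1 term2 sum_eq by linarith
    finally show "measure_pmf.expectation (rademacher_pmf n)
          (\<lambda>\<sigma>. SUP x\<in>X. \<bar>(1 / real n) * (\<Sum>i=1..n. \<sigma> i * F x (z i))\<bar>)
        \<le> N_const L B D \<gamma> CARD('p) l / real n powr l" .
  qed
qed

section \<open>Symmetrization\<close>

declare One_nat_def [simp del] \<comment> \<open>otherwise \<open>{1..n}\<close> is rewritten to \<open>{Suc 0..n}\<close>\<close>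

text \<open>By continuity, the uncountable supremum over X equals the supremum over a countable
  dense subset of X, where measurability is preserved. The bound keeps the real-valued suprema
  meaningful.\<close>

lemma borel_measurable_SUP_continuous:
  fixes h :: "'a::{second_countable_topology, metric_space} \<Rightarrow> 'b \<Rightarrow> real"
  assumes X: "X \<noteq> {}" and meas: "\<And>x. x \<in> X \<Longrightarrow> h x \<in> borel_measurable N"
    and cont: "\<And>w. w \<in> space N \<Longrightarrow> continuous_on X (\<lambda>x. h x w)"
    and bound: "\<And>x w. x \<in> X \<Longrightarrow> w \<in> space N \<Longrightarrow> h x w \<le> B"
  shows "(\<lambda>w. SUP x\<in>X. h x w) \<in> borel_measurable N"
proof -
  obtain A where A: "countable A" "A \<subseteq> X" "X \<subseteq> closure A"
    using separable[of X] by metis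
  have "A \<noteq> {}" using A(3) X by auto
  have bdd: "bdd_above ((\<lambda>x. h x w) ` A)" if "w \<in> space N" for w
    using bound that A(2) by (intro bdd_aboveI2[of _ _ B]) auto
  have "(SUP x\<in>X. h x w) = (SUP x\<in>A. h x w)" if w: "w \<in> space N" for w
  proof (rule antisym)
    show "(SUP x\<in>X. h x w) \<le> (SUP x\<in>A. h x w)"
    proof (rule cSUP_least[OF X])
      fix x assume x: "x \<in> X"
      then obtain s where s: "\<And>k. s k \<in> A" "s \<longlonglongrightarrow> x"
        using A(3) by (metis closure_sequential subsetD)
      have "(\<lambda>k. h (s k) w) \<longlonglongrightarrow> h x w"
        using continuous_on_tendsto_compose[OF cont[OF w] s(2) x] s(1) A(2) by (auto simp: subset_iff)
      moreover have "h (s k) w \<le> (SUP x\<in>A. h x w)" for k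
        by (rule cSUP_upper[OF s(1) bdd[OF w]])
      ultimately show "h x w \<le> (SUP x\<in>A. h x w)"
        by (intro LIMSEQ_le_const2) auto
    qed
    show "(SUP x\<in>A. h x w) \<le> (SUP x\<in>X. h x w)"
      using bound w A(2) \<open>A \<noteq> {}\<close> by (intro cSUP_subset_mono bdd_aboveI2[of _ _ B]) auto
  qed
  then have "(\<lambda>w. SUP x\<in>X. h x w) \<in> borel_measurable N
      \<longleftrightarrow> (\<lambda>w. SUP x\<in>A. h x w) \<in> borel_measurable N"
    by (intro measurable_cong) auto
  then show ?thesis
    using A(1,2) meas bdd by (auto intro!: borel_measurable_cSUP)
qed

text \<open>An i.i.d. family read along an injection is again i.i.d. This one fact serves to tag
  sample points, to swap copies, to forget one of two copies and to cut a block out of the full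
  sample.\<close>

lemma integral_PiM_reindex:
  fixes g :: "('i \<Rightarrow> 'z) \<Rightarrow> real"
  assumes "prob_space \<mu>" "inj_on f I" "f \<in> I \<rightarrow> K" "g \<in> borel_measurable (PiM I (\<lambda>_. \<mu>))"
  shows "(\<integral>w. g (\<lambda>i\<in>I. w (f i)) \<partial>PiM K (\<lambda>_. \<mu>)) = (\<integral>z. g z \<partial>PiM I (\<lambda>_. \<mu>))"
proof -
  have m: "(\<lambda>w. \<lambda>i\<in>I. w (f i)) \<in> measurable (PiM K (\<lambda>_. \<mu>)) (PiM I (\<lambda>_. \<mu>))"
    using assms(3) by (intro measurable_restrict measurable_component_singleton) auto
  show ?thesis
    using distr_PiM_reindex[of K "\<lambda>_. \<mu>" f I] assms integral_distr[OF m assms(4)] by simp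
qed

definition signed_sup ::
  "('x \<Rightarrow> 'z \<Rightarrow> real) \<Rightarrow> 'x set \<Rightarrow> nat \<Rightarrow> (nat \<Rightarrow> real) \<Rightarrow> (nat \<Rightarrow> 'z) \<Rightarrow> real" where
  "signed_sup F X n \<sigma> z = (SUP x\<in>X. \<bar>(1 / real n) * (\<Sum>i=1..n. \<sigma> i * F x (z i))\<bar>)"

definition deviation ::
  "'z measure \<Rightarrow> ('x \<Rightarrow> 'z \<Rightarrow> real) \<Rightarrow> 'x set \<Rightarrow> nat \<Rightarrow> (nat \<Rightarrow> 'z) \<Rightarrow> real" where
  "deviation \<mu> F X n z = (SUP x\<in>X. \<bar>saa_objective F n z x - (\<integral>y. F x y \<partial>\<mu>)\<bar>)"

text \<open>The bound and the continuity hold at every point of the space, not almost everywhere, so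
  all suprema over X are pointwise bounded by explicit constants. For the theorem
  \<open>\<mu>\<close> is the law of the random vector on exactly the set of admissible
  values.\<close>

locale bounded_caratheodory = prob_space \<mu> for \<mu> :: "'z measure" +
  fixes F :: "'x::{second_countable_topology, metric_space} \<Rightarrow> 'z \<Rightarrow> real" and X :: "'x set" and B :: real
    and n :: nat
  assumes X_ne: "X \<noteq> {}" and n_pos: "0 < n"
    and F_meas [measurable]: "\<And>x. x \<in> X \<Longrightarrow> F x \<in> borel_measurable \<mu>"
    and F_cont: "\<And>z. z \<in> space \<mu> \<Longrightarrow> continuous_on X (\<lambda>x. F x z)"
    and F_bound: "\<And>x z. x \<in> X \<Longrightarrow> z \<in> space \<mu> \<Longrightarrow> \<bar>F x z\<bar> \<le> B"
begin

lemma integrable_F: "x \<in> X \<Longrightarrow> integrable \<mu> (F x)"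
  by (rule integrable_const_bound[of _ B]) (auto intro: F_bound)

lemma abs_mean_le: "x \<in> X \<Longrightarrow> \<bar>\<integral>y. F x y \<partial>\<mu>\<bar> \<le> B"
proof -
  assume x: "x \<in> X"
  have "\<bar>\<integral>y. F x y \<partial>\<mu>\<bar> \<le> (\<integral>y. \<bar>F x y\<bar> \<partial>\<mu>)" by (rule integral_abs_bound)
  also have "\<dots> \<le> (\<integral>y. B \<partial>\<mu>)"
    using integrable_F[OF x] F_bound[OF x] by (intro integral_mono) auto
  finally show ?thesis by (simp add: prob_space)
qed

text \<open>Dominated convergence along sequences. The continuity is used twice: for the
  measurability of \<open>deviation\<close> and for the existence of a true minimizer.\<close>

lemma continuous_on_mean: "continuous_on X (\<lambda>x. \<integral>y. F x y \<partial>\<mu>)"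
  unfolding continuous_on_sequentially comp_def
proof safe
  fix s x assume s: "\<forall>k. s k \<in> X" "s \<longlonglongrightarrow> x" and x: "x \<in> X"
  show "(\<lambda>k. \<integral>y. F (s k) y \<partial>\<mu>) \<longlonglongrightarrow> (\<integral>y. F x y \<partial>\<mu>)"
  proof (rule integral_dominated_convergence[where w = "\<lambda>_. B"])
    show "AE y in \<mu>. (\<lambda>k. F (s k) y) \<longlonglongrightarrow> F x y"
      using continuous_on_tendsto_compose[OF F_cont s(2) x] s(1) by auto
  qed (use s x F_bound in \<open>auto intro: F_meas\<close>)
qed

lemma average_le:
  assumes "\<And>i. i \<in> {1..n} \<Longrightarrow> \<bar>a i\<bar> \<le> b"
  shows "\<bar>(1 / real n) * (\<Sum>i=1..n. a i)\<bar> \<le> b"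
proof -
  have "\<bar>(1 / real n) * (\<Sum>i=1..n. a i)\<bar> \<le> (1 / real n) * (\<Sum>i=1..n. \<bar>a i\<bar>)"
    by (simp add: abs_mult divide_right_mono sum_abs)
  also have "\<dots> \<le> (1 / real n) * (\<Sum>i=1..n. b)"
    using assms by (intro mult_left_mono sum_mono) auto
  finally show ?thesis using n_pos by simp
qed

lemma space_PiM_const_D: "z \<in> space (PiM I (\<lambda>_. \<mu>)) \<Longrightarrow> z \<in> I \<rightarrow> space \<mu>"
  by (auto simp: space_PiM)

lemma component_in_space:
  "z \<in> space (PiM I (\<lambda>_. \<mu>)) \<Longrightarrow> i \<in> I \<Longrightarrow> z i \<in> space \<mu>"
  by (auto simp: space_PiM)

lemma saa_deviation_le:
  assumes "x \<in> X" "z \<in> {1..n} \<rightarrow> space \<mu>"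
  shows "\<bar>saa_objective F n z x - (\<integral>y. F x y \<partial>\<mu>)\<bar> \<le> 2 * B"
proof -
  have "\<bar>saa_objective F n z x\<bar> \<le> B"
    unfolding saa_objective_def using assms by (intro average_le F_bound) auto
  then show ?thesis using abs_mean_le[OF assms(1)] by linarith
qed

lemma saa_deviation_le_deviation:
  assumes "x \<in> X" "z \<in> {1..n} \<rightarrow> space \<mu>"
  shows "\<bar>saa_objective F n z x - (\<integral>y. F x y \<partial>\<mu>)\<bar> \<le> deviation \<mu> F X n z"
  unfolding deviation_def using assms
  by (intro cSUP_upper bdd_aboveI2[of _ _ "2 * B"] saa_deviation_le) auto

lemma deviation_bounds:
  assumes "z \<in> {1..n} \<rightarrow> space \<mu>"
  shows "0 \<le> deviation \<mu> F X n z" "deviation \<mu> F X n z \<le> 2 * B"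
proof -
  obtain x where "x \<in> X" using X_ne by auto
  then show "0 \<le> deviation \<mu> F X n z"
    using order.trans[OF abs_ge_zero saa_deviation_le_deviation] assms by blast
  show "deviation \<mu> F X n z \<le> 2 * B"
    unfolding deviation_def using assms X_ne by (intro cSUP_least saa_deviation_le) auto
qed

lemma measurable_deviation: "deviation \<mu> F X n \<in> borel_measurable (PiM {1..n} (\<lambda>_. \<mu>))"
  unfolding deviation_def
proof (rule borel_measurable_SUP_continuous[OF X_ne, where B = "2 * B"])
  fix x assume x: "x \<in> X"
  have [measurable]: "F x \<in> borel_measurable \<mu>" using x by (rule F_meas)
  show "(\<lambda>z. \<bar>saa_objective F n z x - (\<integral>y. F x y \<partial>\<mu>)\<bar>) \<in> borel_measurable (PiM {1..n} (\<lambda>_. \<mu>))"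
    unfolding saa_objective_def by measurable
next
  fix z assume "z \<in> space (PiM {1..n} (\<lambda>_. \<mu>))"
  then show "continuous_on X (\<lambda>x. \<bar>saa_objective F n z x - (\<integral>y. F x y \<partial>\<mu>)\<bar>)"
    unfolding saa_objective_def
    by (intro continuous_intros continuous_on_mean F_cont) (auto intro: component_in_space)
qed (intro saa_deviation_le space_PiM_const_D)

lemma signed_average_le:
  assumes "x \<in> X" "z \<in> {1..n} \<rightarrow> space \<mu>" "\<sigma> \<in> {1..n} \<rightarrow> {-1..1}"
  shows "\<bar>(1 / real n) * (\<Sum>i=1..n. \<sigma> i * F x (z i))\<bar> \<le> B"
proof (rule average_le)
  fix i assume i: "i \<in> {1..n}"
  have "\<bar>\<sigma> i\<bar> \<le> 1"
    using i assms(3) by (auto simp: Pi_iff abs_le_iff)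
  moreover have "\<bar>F x (z i)\<bar> \<le> B"
    using i assms by (intro F_bound) auto
  ultimately have "\<bar>\<sigma> i\<bar> * \<bar>F x (z i)\<bar> \<le> 1 * B"
    by (intro mult_mono) auto
  then show "\<bar>\<sigma> i * F x (z i)\<bar> \<le> B" by (simp add: abs_mult)
qed

lemma signed_average_le_sup:
  assumes "x \<in> X" "z \<in> {1..n} \<rightarrow> space \<mu>" "\<sigma> \<in> {1..n} \<rightarrow> {-1..1}"
  shows "\<bar>(1 / real n) * (\<Sum>i=1..n. \<sigma> i * F x (z i))\<bar> \<le> signed_sup F X n \<sigma> z"
  unfolding signed_sup_def using assms
  by (intro cSUP_upper bdd_aboveI2[of _ _ B] signed_average_le) auto

lemma signed_sup_bounds:
  assumes "z \<in> {1..n} \<rightarrow> space \<mu>" "\<sigma> \<in> {1..n} \<rightarrow> {-1..1}"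
  shows "0 \<le> signed_sup F X n \<sigma> z" "signed_sup F X n \<sigma> z \<le> B"
proof -
  obtain x where "x \<in> X" using X_ne by auto
  then show "0 \<le> signed_sup F X n \<sigma> z"
    using order.trans[OF abs_ge_zero signed_average_le_sup] assms by blast
  show "signed_sup F X n \<sigma> z \<le> B"
    unfolding signed_sup_def using assms X_ne by (intro cSUP_least signed_average_le) auto
qed

lemma measurable_signed_sup:
  assumes "\<sigma> \<in> {1..n} \<rightarrow> {-1..1}"
  shows "signed_sup F X n \<sigma> \<in> borel_measurable (PiM {1..n} (\<lambda>_. \<mu>))"
  unfolding signed_sup_def
proof (rule borel_measurable_SUP_continuous[OF X_ne, where B = B])
  fix x assume x: "x \<in> X"
  have [measurable]: "F x \<in> borel_measurable \<mu>" using x by (rule F_meas)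
  show "(\<lambda>z. \<bar>(1 / real n) * (\<Sum>i=1..n. \<sigma> i * F x (z i))\<bar>) \<in> borel_measurable (PiM {1..n} (\<lambda>_. \<mu>))"
    by measurable
next
  fix z assume "z \<in> space (PiM {1..n} (\<lambda>_. \<mu>))"
  then show "continuous_on X (\<lambda>x. \<bar>(1 / real n) * (\<Sum>i=1..n. \<sigma> i * F x (z i))\<bar>)"
    by (intro continuous_intros F_cont) (auto intro: component_in_space)
qed (intro signed_average_le space_PiM_const_D assms)

text \<open>A sample and its independent ghost copy are stored as one family, with the Boolean
  telling the copies apart. Swapping the copies at chosen positions thereby becomes a mere
  permutation of the index set.\<close>

definition ghost_sup :: "(nat \<Rightarrow> real) \<Rightarrow> (nat \<times> bool \<Rightarrow> 'z) \<Rightarrow> real" where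
  "ghost_sup \<sigma> w = (SUP x\<in>X. \<bar>(1 / real n) * (\<Sum>i=1..n. \<sigma> i * (F x (w (i, True)) - F x (w (i, False))))\<bar>)"

lemma ghost_average_le:
  assumes "x \<in> X" "w \<in> {1..n} \<times> UNIV \<rightarrow> space \<mu>" "\<sigma> \<in> {1..n} \<rightarrow> {-1..1}"
  shows "\<bar>(1 / real n) * (\<Sum>i=1..n. \<sigma> i * (F x (w (i, True)) - F x (w (i, False))))\<bar>
           \<le> signed_sup F X n \<sigma> (\<lambda>i. w (i, True)) + signed_sup F X n \<sigma> (\<lambda>i. w (i, False))"
proof -
  have "(1 / real n) * (\<Sum>i=1..n. \<sigma> i * (F x (w (i, True)) - F x (w (i, False))))
      = (1 / real n) * (\<Sum>i=1..n. \<sigma> i * F x (w (i, True)))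
        - (1 / real n) * (\<Sum>i=1..n. \<sigma> i * F x (w (i, False)))"
    by (simp add: right_diff_distrib sum_subtractf)
  moreover have *: "\<bar>(1 / real n) * (\<Sum>i=1..n. \<sigma> i * F x (w (i, b)))\<bar> \<le> signed_sup F X n \<sigma> (\<lambda>i. w (i, b))" for b
    using assms by (intro signed_average_le_sup) (auto simp: Pi_iff)
  ultimately show ?thesis
    using order.trans[OF abs_triangle_ineq4 add_mono[OF *[of True] *[of False]]] by presburger
qed

lemma ghost_sup_le:
  assumes "w \<in> {1..n} \<times> UNIV \<rightarrow> space \<mu>" "\<sigma> \<in> {1..n} \<rightarrow> {-1..1}"
  shows "ghost_sup \<sigma> w \<le> signed_sup F X n \<sigma> (\<lambda>i. w (i, True)) + signed_sup F X n \<sigma> (\<lambda>i. w (i, False))"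
  unfolding ghost_sup_def using assms by (intro cSUP_least ghost_average_le X_ne) auto

lemma ghost_average_le_sup:
  assumes "x \<in> X" "w \<in> {1..n} \<times> UNIV \<rightarrow> space \<mu>" "\<sigma> \<in> {1..n} \<rightarrow> {-1..1}"
  shows "\<bar>(1 / real n) * (\<Sum>i=1..n. \<sigma> i * (F x (w (i, True)) - F x (w (i, False))))\<bar> \<le> ghost_sup \<sigma> w"
  unfolding ghost_sup_def using assms
  by (intro cSUP_upper bdd_aboveI2[OF ghost_average_le]) auto

lemma ghost_sup_bounds:
  assumes "w \<in> {1..n} \<times> UNIV \<rightarrow> space \<mu>" "\<sigma> \<in> {1..n} \<rightarrow> {-1..1}"
  shows "0 \<le> ghost_sup \<sigma> w" "ghost_sup \<sigma> w \<le> 2 * B"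
proof -
  obtain x where "x \<in> X" using X_ne by auto
  then show "0 \<le> ghost_sup \<sigma> w"
    using order.trans[OF abs_ge_zero ghost_average_le_sup] assms by blast
  show "ghost_sup \<sigma> w \<le> 2 * B"
  proof -
    have "signed_sup F X n \<sigma> (\<lambda>i. w (i, b)) \<le> B" for b
      using assms by (intro signed_sup_bounds) (auto simp: Pi_iff)
    from add_mono[OF this[of True] this[of False]] show ?thesis
      using order.trans[OF ghost_sup_le[OF assms]] by simp
  qed
qed

lemma measurable_ghost_sup:
  assumes "\<sigma> \<in> {1..n} \<rightarrow> {-1..1}"
  shows "ghost_sup \<sigma> \<in> borel_measurable (PiM ({1..n} \<times> UNIV) (\<lambda>_. \<mu>))"
  unfolding ghost_sup_def
proof (rule borel_measurable_SUP_continuous[OF X_ne, where B = "2 * B"])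
  fix x assume x: "x \<in> X"
  have [measurable]: "F x \<in> borel_measurable \<mu>" using x by (rule F_meas)
  show "(\<lambda>w. \<bar>(1 / real n) * (\<Sum>i=1..n. \<sigma> i * (F x (w (i, True)) - F x (w (i, False))))\<bar>)
      \<in> borel_measurable (PiM ({1..n} \<times> UNIV) (\<lambda>_. \<mu>))"
    by measurable
next
  fix w :: "nat \<times> bool \<Rightarrow> 'z" assume "w \<in> space (PiM ({1..n} \<times> UNIV) (\<lambda>_. \<mu>))"
  then show "continuous_on X
      (\<lambda>x. \<bar>(1 / real n) * (\<Sum>i=1..n. \<sigma> i * (F x (w (i, True)) - F x (w (i, False))))\<bar>)"
    by (intro continuous_intros F_cont) (auto intro: component_in_space)
next
  fix x and w :: "nat \<times> bool \<Rightarrow> 'z"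
  assume x: "x \<in> X" and "w \<in> space (PiM ({1..n} \<times> UNIV) (\<lambda>_. \<mu>))"
  then have w: "w \<in> {1..n} \<times> UNIV \<rightarrow> space \<mu>" by (intro space_PiM_const_D)
  show "\<bar>(1 / real n) * (\<Sum>i=1..n. \<sigma> i * (F x (w (i, True)) - F x (w (i, False))))\<bar> \<le> 2 * B"
    by (rule order.trans[OF ghost_average_le_sup[OF x w assms] ghost_sup_bounds(2)[OF w assms]])
qed

lemma prob_space_PiM_const: "prob_space (PiM I (\<lambda>_. \<mu>))"
  by (intro prob_space_PiM) (rule prob_space_axioms)

lemma integrable_PiM_bounded:
  fixes g :: "('i \<Rightarrow> 'z) \<Rightarrow> real"
  assumes "g \<in> borel_measurable (PiM I (\<lambda>_. \<mu>))" "\<And>w. w \<in> space (PiM I (\<lambda>_. \<mu>)) \<Longrightarrow> 0 \<le> g w \<and> g w \<le> b"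
  shows "integrable (PiM I (\<lambda>_. \<mu>)) g"
proof -
  interpret P: prob_space "PiM I (\<lambda>_. \<mu>)" by (rule prob_space_PiM_const)
  show ?thesis using assms by (intro P.integrable_const_bound[of _ b]) auto
qed

lemma integrable_signed_sup:
  assumes "\<sigma> \<in> {1..n} \<rightarrow> {-1..1}"
  shows "integrable (PiM {1..n} (\<lambda>_. \<mu>)) (signed_sup F X n \<sigma>)"
  by (intro integrable_PiM_bounded[of _ _ B] measurable_signed_sup conjI signed_sup_bounds space_PiM_const_D assms)

lemma integrable_ghost_sup:
  assumes "\<sigma> \<in> {1..n} \<rightarrow> {-1..1}"
  shows "integrable (PiM ({1..n} \<times> UNIV) (\<lambda>_. \<mu>)) (ghost_sup \<sigma>)"
  by (intro integrable_PiM_bounded[of _ _ "2 * B"] measurable_ghost_sup conjI ghost_sup_bounds space_PiM_const_D assms)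

text \<open>The mean objective is the integral of the sample objective of the ghost copy, and a
  supremum of integrals is at most the integral of the supremum. The merged product law then treats
  both copies as one family.\<close>

lemma expectation_deviation_le_ghost:
  "(\<integral>z. deviation \<mu> F X n z \<partial>PiM {1..n} (\<lambda>_. \<mu>))
     \<le> (\<integral>w. ghost_sup (\<lambda>_. 1) w \<partial>PiM ({1..n} \<times> UNIV) (\<lambda>_. \<mu>))"
proof -
  let ?I = "{1..n} \<times> {True}" and ?J = "{1..n} \<times> {False}"
  let ?P = "\<lambda>K :: (nat \<times> bool) set. PiM K (\<lambda>_. \<mu>)"
  let ?z = "\<lambda>u. \<lambda>i\<in>{1..n}. u (i, True)"
  interpret S: product_sigma_finite "\<lambda>_ :: nat \<times> bool. \<mu>"
    by standard
  interpret PJ: prob_space "?P ?J" by (rule prob_space_PiM_const)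
  have IJ: "?I \<inter> ?J = {}" "?I \<union> ?J = {1..n} \<times> UNIV" by (auto simp: UNIV_bool)
  have int: "integrable (?P (?I \<union> ?J)) (ghost_sup (\<lambda>_. 1))"
    unfolding IJ by (rule integrable_ghost_sup) auto
  \<comment> \<open>Integrability is transported from the merged family to the pair of copies, where
    Fubini can be applied.\<close>
  have fold_int: "integrable (?P ?I \<Otimes>\<^sub>M ?P ?J) (\<lambda>p. ghost_sup (\<lambda>_. 1) (merge ?I ?J p))"
  proof (subst integrable_distr_eq[symmetric, where g = "merge ?I ?J" and N = "?P (?I \<union> ?J)"])
    show "ghost_sup (\<lambda>_. 1) \<in> borel_measurable (?P (?I \<union> ?J))"
      using int by (rule borel_measurable_integrable)
    show "integrable (distr (?P ?I \<Otimes>\<^sub>M ?P ?J) (?P (?I \<union> ?J)) (merge ?I ?J)) (ghost_sup (\<lambda>_. 1))"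
      using int by (subst S.distr_merge[OF IJ(1)]) auto
  qed (rule measurable_merge)
  interpret PP: pair_sigma_finite "?P ?I" "?P ?J"
    by (intro pair_sigma_finite.intro prob_space_imp_sigma_finite prob_space_PiM_const)
  have "(\<integral>z. deviation \<mu> F X n z \<partial>PiM {1..n} (\<lambda>_. \<mu>)) = (\<integral>u. deviation \<mu> F X n (?z u) \<partial>?P ?I)"
    by (subst integral_PiM_reindex[symmetric, where f = "\<lambda>i. (i, True)" and K = ?I])
      (auto intro: prob_space_axioms measurable_deviation inj_onI)
  also have "\<dots> \<le> (\<integral>u. (\<integral>v. ghost_sup (\<lambda>_. 1) (merge ?I ?J (u, v)) \<partial>?P ?J) \<partial>?P ?I)"
  proof (rule integral_mono_AE)
    show "integrable (?P ?I) (\<lambda>u. deviation \<mu> F X n (?z u))"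
      by (intro integrable_PiM_bounded[of _ _ "2 * B"] measurable_compose[OF _ measurable_deviation]
          measurable_restrict measurable_component_singleton conjI deviation_bounds)
        (auto intro: component_in_space)
    show "integrable (?P ?I) (\<lambda>u. \<integral>v. ghost_sup (\<lambda>_. 1) (merge ?I ?J (u, v)) \<partial>?P ?J)"
      using PP.integrable_fst'[OF fold_int] by simp
    show "AE u in ?P ?I. deviation \<mu> F X n (?z u)
        \<le> (\<integral>v. ghost_sup (\<lambda>_. 1) (merge ?I ?J (u, v)) \<partial>?P ?J)"
      \<comment> \<open>Fubini gives integrability in the ghost copy only for almost every u, so the
        comparison is an almost sure one; \<open>AE_space\<close> supplies membership of u in the
        space.\<close>
      using PP.AE_integrable_fst'[OF fold_int] AE_space
    proof eventually_elim
      fix u assume int_v: "integrable (?P ?J) (\<lambda>v. ghost_sup (\<lambda>_. 1) (merge ?I ?J (u, v)))"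
        and u: "u \<in> space (?P ?I)"
      show "deviation \<mu> F X n (?z u) \<le> (\<integral>v. ghost_sup (\<lambda>_. 1) (merge ?I ?J (u, v)) \<partial>?P ?J)"
        unfolding deviation_def
      proof (rule cSUP_least[OF X_ne])
        fix x assume x: "x \<in> X"
        have [measurable]: "F x \<in> borel_measurable \<mu>" using x by (rule F_meas)
        have marg: "(\<integral>v. F x (v j) \<partial>?P ?J) = (\<integral>y. F x y \<partial>\<mu>)" and
          int_j: "integrable (?P ?J) (\<lambda>v. F x (v j))" if "j \<in> ?J" for j
        proof -
          have *: "distr (?P ?J) \<mu> (\<lambda>v. v j) = \<mu>"
            using that by (intro distr_PiM_component) (auto intro: prob_space_axioms)
          have m: "(\<lambda>v. v j) \<in> measurable (?P ?J) \<mu>"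
            using that by (rule measurable_component_singleton)
          show "(\<integral>v. F x (v j) \<partial>?P ?J) = (\<integral>y. F x y \<partial>\<mu>)"
            using integral_distr[OF m, of "F x"] * by simp
          show "integrable (?P ?J) (\<lambda>v. F x (v j))"
            using integrable_distr_eq[OF m, of "F x"] * integrable_F[OF x] by simp
        qed
        let ?d = "\<lambda>v. (1 / real n) * (\<Sum>i=1..n. (F x (u (i, True)) - F x (v (i, False))))"
        have int_d: "integrable (?P ?J) ?d"
          using int_j by (intro integrable_mult_right Bochner_Integration.integrable_sum
              Bochner_Integration.integrable_diff PJ.integrable_const) auto
        \<comment> \<open>Each ghost coordinate has law \<open>\<mu>\<close>, so the mean can be
          written as an integral over v; the absolute value and then the supremum over x move under
          that integral.\<close>
        have "saa_objective F n (?z u) x - (\<integral>y. F x y \<partial>\<mu>)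
            = (1 / real n) * (\<Sum>i=1..n. (F x (u (i, True)) - (\<integral>y. F x y \<partial>\<mu>)))"
          using n_pos by (simp add: saa_objective_def sum_subtractf field_simps)
        also have "\<dots> = (\<integral>v. ?d v \<partial>?P ?J)"
          using int_j marg by (simp add: PJ.prob_space)
        finally have "\<bar>saa_objective F n (?z u) x - (\<integral>y. F x y \<partial>\<mu>)\<bar> \<le> (\<integral>v. \<bar>?d v\<bar> \<partial>?P ?J)"
          using integral_abs_bound[of "?P ?J" ?d] by simp
        also have "\<dots> \<le> (\<integral>v. ghost_sup (\<lambda>_. 1) (merge ?I ?J (u, v)) \<partial>?P ?J)"
        proof (rule integral_mono)
          fix v assume v: "v \<in> space (?P ?J)"
          have mv: "merge ?I ?J (u, v) (i, b) = (if b then u (i, True) else v (i, False))" if "i \<in> {1..n}" for i b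
            using that by (simp add: merge_def)
          have "merge ?I ?J (u, v) \<in> {1..n} \<times> UNIV \<rightarrow> space \<mu>"
            using component_in_space[OF u] component_in_space[OF v] by (auto simp: mv)
          from ghost_average_le_sup[OF x this, of "\<lambda>_. 1"]
          show "\<bar>?d v\<bar> \<le> ghost_sup (\<lambda>_. 1) (merge ?I ?J (u, v))"
            by (simp add: mv)
        qed (rule integrable_abs[OF int_d], rule int_v)
        finally show "\<bar>saa_objective F n (?z u) x - (\<integral>y. F x y \<partial>\<mu>)\<bar>
            \<le> (\<integral>v. ghost_sup (\<lambda>_. 1) (merge ?I ?J (u, v)) \<partial>?P ?J)" .
      qed
    qed
  qed
  also have "\<dots> = (\<integral>w. ghost_sup (\<lambda>_. 1) w \<partial>?P (?I \<union> ?J))"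
    by (rule S.product_integral_fold[OF IJ(1) _ _ int, symmetric]) auto
  finally show ?thesis unfolding IJ .
qed

text \<open>Swapping the two copies of the i-th sample point preserves the product law and flips the sign
  of the i-th difference.\<close>
lemma expectation_ghost_sup_sign_invariant:
  assumes "\<And>i. i \<in> {1..n} \<Longrightarrow> \<sigma> i = 1 \<or> \<sigma> i = - 1"
  shows "(\<integral>w. ghost_sup (\<lambda>_. 1) w \<partial>PiM ({1..n} \<times> UNIV) (\<lambda>_. \<mu>))
       = (\<integral>w. ghost_sup \<sigma> w \<partial>PiM ({1..n} \<times> UNIV) (\<lambda>_. \<mu>))"
proof -
  let ?K = "{1..n} \<times> (UNIV :: bool set)"
  define f where "f = (\<lambda>(i :: nat, b). (i, if \<sigma> i = 1 then b else \<not> b))"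
  have "(\<integral>w. ghost_sup (\<lambda>_. 1) w \<partial>PiM ?K (\<lambda>_. \<mu>))
      = (\<integral>w. ghost_sup (\<lambda>_. 1) (\<lambda>k\<in>?K. w (f k)) \<partial>PiM ?K (\<lambda>_. \<mu>))"
    by (rule integral_PiM_reindex[symmetric])
      (auto simp: f_def inj_on_def intro: prob_space_axioms measurable_ghost_sup split: if_splits)
  also have "\<dots> = (\<integral>w. ghost_sup \<sigma> w \<partial>PiM ?K (\<lambda>_. \<mu>))"
  proof (rule Bochner_Integration.integral_cong[OF refl])
    fix w
    show "ghost_sup (\<lambda>_. 1) (\<lambda>k\<in>?K. w (f k)) = ghost_sup \<sigma> w"
    proof -
      have "1 * (F x ((\<lambda>k\<in>?K. w (f k)) (i, True)) - F x ((\<lambda>k\<in>?K. w (f k)) (i, False)))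
          = \<sigma> i * (F x (w (i, True)) - F x (w (i, False)))" if "i \<in> {1..n}" for x i
        using assms[OF that] that by (auto simp: f_def)
      then show ?thesis
        unfolding ghost_sup_def by (intro SUP_cong refl) (simp only: cong: sum.cong)
    qed
  qed
  finally show ?thesis .
qed

text \<open>The signed difference splits into one signed average per copy, and both copies have the
  same law: this is the factor 2 of symmetrization.\<close>

lemma expectation_ghost_sup_le:
  assumes "\<sigma> \<in> {1..n} \<rightarrow> {-1..1}"
  shows "(\<integral>w. ghost_sup \<sigma> w \<partial>PiM ({1..n} \<times> UNIV) (\<lambda>_. \<mu>))
       \<le> 2 * (\<integral>z. signed_sup F X n \<sigma> z \<partial>PiM {1..n} (\<lambda>_. \<mu>))"
proof -
  let ?K = "{1..n} \<times> (UNIV :: bool set)"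
  let ?r = "\<lambda>b w. \<lambda>i\<in>{1..n}. w (i, b)"
  \<comment> \<open>\<open>signed_sup\<close> reads only the coordinates in \<open>{1..n}\<close>,
    so the restriction that makes the sample extensional, as points of a product space must be,
    changes nothing.\<close>
  have restr: "signed_sup F X n \<sigma> (\<lambda>i. w (i, b)) = signed_sup F X n \<sigma> (?r b w)" for w and b :: bool
    by (simp add: signed_sup_def)
  have eq: "(\<integral>w. signed_sup F X n \<sigma> (?r b w) \<partial>PiM ?K (\<lambda>_. \<mu>))
      = (\<integral>z. signed_sup F X n \<sigma> z \<partial>PiM {1..n} (\<lambda>_. \<mu>))" for b
    by (rule integral_PiM_reindex) (auto intro: prob_space_axioms measurable_signed_sup[OF assms] inj_onI)
  have int: "integrable (PiM ?K (\<lambda>_. \<mu>)) (\<lambda>w. signed_sup F X n \<sigma> (?r b w))" for b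
    by (intro integrable_PiM_bounded[of _ _ B] measurable_compose[OF _ measurable_signed_sup]
        measurable_restrict measurable_component_singleton conjI signed_sup_bounds assms)
      (auto intro: component_in_space)
  have "(\<integral>w. ghost_sup \<sigma> w \<partial>PiM ?K (\<lambda>_. \<mu>))
      \<le> (\<integral>w. signed_sup F X n \<sigma> (?r True w) + signed_sup F X n \<sigma> (?r False w) \<partial>PiM ?K (\<lambda>_. \<mu>))"
  proof (rule integral_mono)
    fix w :: "nat \<times> bool \<Rightarrow> 'z" assume "w \<in> space (PiM ?K (\<lambda>_. \<mu>))"
    then have "w \<in> {1..n} \<times> UNIV \<rightarrow> space \<mu>" by (rule space_PiM_const_D)
    from ghost_sup_le[OF this assms]
    show "ghost_sup \<sigma> w \<le> signed_sup F X n \<sigma> (?r True w) + signed_sup F X n \<sigma> (?r False w)"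
      by (simp add: restr)
  qed (use int integrable_ghost_sup[OF assms] in auto)
  also have "\<dots> = 2 * (\<integral>z. signed_sup F X n \<sigma> z \<partial>PiM {1..n} (\<lambda>_. \<mu>))"
    using int by (simp add: eq)
  finally show ?thesis .
qed

text \<open>A real-valued \<open>SUP\<close> is an upper bound only for a family that is bounded
  above; this licenses passing from one sample to \<open>rademacher_average\<close>.\<close>

lemma bdd_above_rademacher_average:
  "bdd_above ((\<lambda>z. measure_pmf.expectation (rademacher_pmf n) (\<lambda>\<sigma>. signed_sup F X n \<sigma> z))
     ` ({1..n} \<rightarrow>\<^sub>E space \<mu>))"
proof (rule bdd_aboveI2)
  fix z assume z: "z \<in> {1..n} \<rightarrow>\<^sub>E space \<mu>"
  have "measure_pmf.expectation (rademacher_pmf n) (\<lambda>\<sigma>. signed_sup F X n \<sigma> z)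
      \<le> measure_pmf.expectation (rademacher_pmf n) (\<lambda>_. B)"
  proof (intro integral_mono_AE AE_pmfI)
    fix \<sigma> assume "\<sigma> \<in> set_pmf (rademacher_pmf n)"
    then have "\<sigma> \<in> {1..n} \<rightarrow> {-1..1}" using rademacher_pmf_range by fastforce
    then show "signed_sup F X n \<sigma> z \<le> B"
      using z by (intro signed_sup_bounds) auto
  qed auto
  then show "measure_pmf.expectation (rademacher_pmf n) (\<lambda>\<sigma>. signed_sup F X n \<sigma> z) \<le> B"
    by simp
qed

text \<open>The ghost bound holds for every fixed sign pattern, hence also on average over the
  patterns. After exchanging the sign average with the sample integral, every sample is dominated by
  the supremum over samples.\<close>

lemma expectation_deviation_le:
  "(\<integral>z. deviation \<mu> F X n z \<partial>PiM {1..n} (\<lambda>_. \<mu>)) \<le> 2 * rademacher_average F X (space \<mu>) n"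
proof -
  let ?P = "PiM {1..n} (\<lambda>_. \<mu>)"
  let ?p = "rademacher_pmf n"
  interpret P: prob_space ?P by (rule prob_space_PiM_const)
  have sgn: "\<sigma> \<in> {1..n} \<rightarrow> {-1..1}" if "\<sigma> \<in> set_pmf ?p" for \<sigma>
    using rademacher_pmf_range[OF that] by fastforce
  have int_\<sigma>: "integrable ?P (\<lambda>z. signed_sup F X n \<sigma> z)" if "\<sigma> \<in> set_pmf ?p" for \<sigma>
    using integrable_signed_sup[OF sgn[OF that]] .
  have fin: "finite (set_pmf ?p)" by (rule finite_set_rademacher_pmf)
  \<comment> \<open>There are finitely many sign patterns, so the exchange is linearity of the
    integral over a finite sum.\<close>
  have E: "measure_pmf.expectation ?p g = (\<Sum>\<sigma>\<in>set_pmf ?p. pmf ?p \<sigma> * g \<sigma>)" for g :: "_ \<Rightarrow> real"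
    using integral_measure_pmf[OF fin, of ?p g] by simp
  have "(\<integral>z. deviation \<mu> F X n z \<partial>?P)
      = measure_pmf.expectation ?p (\<lambda>_. \<integral>z. deviation \<mu> F X n z \<partial>?P)"
    by simp
  also have "\<dots> \<le> measure_pmf.expectation ?p (\<lambda>\<sigma>. 2 * (\<integral>z. signed_sup F X n \<sigma> z \<partial>?P))"
  proof (intro integral_mono_AE AE_pmfI)
    fix \<sigma> assume \<sigma>: "\<sigma> \<in> set_pmf ?p"
    have "(\<integral>z. deviation \<mu> F X n z \<partial>?P) \<le> (\<integral>w. ghost_sup \<sigma> w \<partial>PiM ({1..n} \<times> UNIV) (\<lambda>_. \<mu>))"
      using expectation_deviation_le_ghost expectation_ghost_sup_sign_invariant rademacher_pmf_range[OF \<sigma>]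
      by metis
    also have "\<dots> \<le> 2 * (\<integral>z. signed_sup F X n \<sigma> z \<partial>?P)"
      by (rule expectation_ghost_sup_le[OF sgn[OF \<sigma>]])
    finally show "(\<integral>z. deviation \<mu> F X n z \<partial>?P) \<le> 2 * (\<integral>z. signed_sup F X n \<sigma> z \<partial>?P)" .
  qed auto
  also have "\<dots> = 2 * (\<integral>z. measure_pmf.expectation ?p (\<lambda>\<sigma>. signed_sup F X n \<sigma> z) \<partial>?P)"
    unfolding E using int_\<sigma> by (subst Bochner_Integration.integral_sum) (auto simp: sum_distrib_left mult_ac)
  also have "\<dots> \<le> 2 * (\<integral>z. rademacher_average F X (space \<mu>) n \<partial>?P)"
  proof (intro mult_left_mono integral_mono)
    show "integrable ?P (\<lambda>z. measure_pmf.expectation ?p (\<lambda>\<sigma>. signed_sup F X n \<sigma> z))"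
      unfolding E using int_\<sigma> by auto
    fix z assume "z \<in> space ?P"
    then have "z \<in> {1..n} \<rightarrow>\<^sub>E space \<mu>" by (simp add: space_PiM)
    from cSUP_upper[OF this bdd_above_rademacher_average]
    show "measure_pmf.expectation ?p (\<lambda>\<sigma>. signed_sup F X n \<sigma> z) \<le> rademacher_average F X (space \<mu>) n"
      unfolding rademacher_average_def signed_sup_def .
  qed auto
  finally show ?thesis by (simp add: P.prob_space)
qed

end

section \<open>The compromise decision problem\<close>

text \<open>The deterministic core, applied separately at each outcome: it sees the replications
  only through their uniform deviations, and probability enters afterwards through the moments of
  the sum of the \<open>\<delta> i\<close>.\<close>

lemma compromise_value_deviation_le:
  fixes f :: "'v::real_normed_vector \<Rightarrow> real" and fs :: "nat \<Rightarrow> 'v \<Rightarrow> real" and xs :: "nat \<Rightarrow> 'v"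
  assumes m: "0 < m" and \<rho>: "0 \<le> \<rho>"
    and opt: "x\<^sub>0 \<in> X" "\<And>y. y \<in> X \<Longrightarrow> f x\<^sub>0 \<le> f y"
    and conv: "\<And>i. i \<in> {1..m} \<Longrightarrow> convex_on X (fs i)"
    and xs: "\<And>i. i \<in> {1..m} \<Longrightarrow> xs i \<in> X" "\<And>i y. i \<in> {1..m} \<Longrightarrow> y \<in> X \<Longrightarrow> fs i (xs i) \<le> fs i y"
    and dev: "\<And>i x. i \<in> {1..m} \<Longrightarrow> x \<in> X \<Longrightarrow> \<bar>fs i x - f x\<bar> \<le> \<delta> i"
  shows "\<bar>opt_value (\<lambda>x. (1 / real m) * (\<Sum>i=1..m. fs i x)
             + \<rho> / 2 * (norm (x - (1 / real m) *\<^sub>R (\<Sum>i=1..m. xs i)))\<^sup>2) X - f x\<^sub>0\<bar>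
           \<le> (3 * real m - 2) / (real m)\<^sup>2 * (\<Sum>i=1..m. \<delta> i)"
proof -
  define xbar where "xbar = (1 / real m) *\<^sub>R (\<Sum>i=1..m. xs i)"
  define S where "S = (\<Sum>i=1..m. \<delta> i)"
  define obj where "obj x = (1 / real m) * (\<Sum>i=1..m. fs i x) + \<rho> / 2 * (norm (x - xbar))\<^sup>2" for x
  have "0 \<le> \<delta> i" if "i \<in> {1..m}" for i
    using order.trans[OF abs_ge_zero dev[OF that opt(1)]] .
  then have S: "0 \<le> S" unfolding S_def by (intro sum_nonneg) auto
  have xbar_sum: "xbar = (\<Sum>i=1..m. (1 / real m) *\<^sub>R xs i)"
    by (simp add: xbar_def scaleR_sum_right)
  \<comment> \<open>\<open>convex_on\<close> includes convexity of the domain, and m > 0 guarantees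
    that there is a first replication to take it from.\<close>
  have "convex X" using conv[of 1] m by (auto intro: convex_on_imp_convex)
  then have xbar: "xbar \<in> X"
    unfolding xbar_sum using m xs(1) by (intro convex_sum) auto
  have lower: "f x\<^sub>0 - S / real m \<le> obj x" if x: "x \<in> X" for x
  proof -
    have "f x\<^sub>0 - S / real m = (1 / real m) * (\<Sum>i=1..m. f x\<^sub>0 - \<delta> i)"
      using m by (simp add: S_def sum_subtractf field_simps)
    also have "\<dots> \<le> (1 / real m) * (\<Sum>i=1..m. fs i x)"
    proof (intro mult_left_mono sum_mono)
      fix i assume i: "i \<in> {1..m}"
      show "f x\<^sub>0 - \<delta> i \<le> fs i x" using dev[OF i x] opt(2)[OF x] by linarith
    qed auto
    also have "\<dots> \<le> obj x" using \<rho> by (simp add: obj_def)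
    finally show ?thesis .
  qed
  \<comment> \<open>The chain runs from \<open>fs i\<close> to \<open>f\<close> to
    \<open>fs j\<close> at \<open>xs j\<close>, by optimality to \<open>fs j\<close> at
    \<open>x\<^sub>0\<close>, and back to \<open>f\<close>: the cost is \<open>\<delta> i\<close>
    plus twice \<open>\<delta> j\<close>. For j = i the first two passages disappear and a single
    deviation remains.\<close>
  have cross: "fs i (xs j) \<le> f x\<^sub>0 + \<delta> i + 2 * \<delta> j - (if j = i then 2 * \<delta> i else 0)"
    if i: "i \<in> {1..m}" and j: "j \<in> {1..m}" for i j
  proof (cases "j = i")
    case True
    then show ?thesis using xs(2)[OF i opt(1)] dev[OF i opt(1)] by simp
  next
    case False
    then show ?thesis
      using dev[OF i xs(1)[OF j]] dev[OF j xs(1)[OF j]] xs(2)[OF j opt(1)] dev[OF j opt(1)] by simp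
  qed
  have "fs i xbar \<le> f x\<^sub>0 + \<delta> i + (2 * S - 2 * \<delta> i) / real m" if i: "i \<in> {1..m}" for i
  proof -
    have "fs i xbar \<le> (\<Sum>j=1..m. 1 / real m * fs i (xs j))"
      unfolding xbar_sum using m xs(1) by (intro convex_on_sum[OF _ _ conv[OF i]]) auto
    also have "\<dots> \<le> (\<Sum>j=1..m. 1 / real m * (f x\<^sub>0 + \<delta> i + 2 * \<delta> j - (if j = i then 2 * \<delta> i else 0)))"
      using i by (intro sum_mono mult_left_mono cross) auto
    also have "\<dots> = 1 / real m * (\<Sum>j=1..m. (f x\<^sub>0 + \<delta> i + 2 * \<delta> j - (if j = i then 2 * \<delta> i else 0)))"
      by (simp only: sum_distrib_left)
    also have "(\<Sum>j=1..m. (f x\<^sub>0 + \<delta> i + 2 * \<delta> j - (if j = i then 2 * \<delta> i else 0)))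
        = real m * (f x\<^sub>0 + \<delta> i) + 2 * S - 2 * \<delta> i"
      unfolding sum_subtractf sum.distrib S_def sum_distrib_left[symmetric]
      using i by (simp add: sum.delta algebra_simps)
    finally show ?thesis using m by (simp add: field_simps)
  qed
  then have "(\<Sum>i=1..m. fs i xbar) \<le> (\<Sum>i=1..m. f x\<^sub>0 + \<delta> i + (2 * S - 2 * \<delta> i) / real m)"
    by (rule sum_mono)
  also have "\<dots> = real m * f x\<^sub>0 + S + (2 * real m * S - 2 * S) / real m"
    unfolding S_def sum.distrib sum_divide_distrib[symmetric] sum_subtractf sum_distrib_left[symmetric]
    by (simp add: algebra_simps)
  finally have "obj xbar \<le> (1 / real m) * (real m * f x\<^sub>0 + S + (2 * real m * S - 2 * S) / real m)"
    by (simp add: obj_def divide_right_mono)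
  also have "\<dots> = f x\<^sub>0 + (3 * real m - 2) / (real m)\<^sup>2 * S"
    using m by (simp add: field_simps power2_eq_square)
  finally have upper: "obj xbar \<le> f x\<^sub>0 + (3 * real m - 2) / (real m)\<^sup>2 * S" .
  have "opt_value obj X \<le> obj xbar"
    unfolding opt_value_def using lower xbar by (intro cINF_lower bdd_belowI2) auto
  moreover have "f x\<^sub>0 - S / real m \<le> opt_value obj X"
    unfolding opt_value_def using lower xbar by (intro cINF_greatest) auto
  \<comment> \<open>The upper estimate has the worse constant, since m <= 3m - 2 for m >= 1, and
    therefore covers both directions.\<close>
  moreover have "S / real m \<le> (3 * real m - 2) / (real m)\<^sup>2 * S"
  proof -
    have "S / real m = real m / (real m)\<^sup>2 * S" by (simp add: power2_eq_square)
    also have "\<dots> \<le> (3 * real m - 2) / (real m)\<^sup>2 * S"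
      using m S by (intro mult_right_mono divide_right_mono) auto
    finally show ?thesis .
  qed
  ultimately have "\<bar>opt_value obj X - f x\<^sub>0\<bar> \<le> (3 * real m - 2) / (real m)\<^sup>2 * S"
    using upper by linarith
  then show ?thesis
    unfolding obj_def S_def xbar_def .
qed

section \<open>Convexity, independence and second moments of the replications\<close>

lemma convex_on_saa_objective:
  assumes "convex X" "\<And>j. j \<in> {1..n} \<Longrightarrow> convex_on X (\<lambda>x. F x (z j))"
  shows "convex_on X (saa_objective F n z)"
proof -
  have "convex_on X (\<lambda>x. \<Sum>j\<in>J. F x (z j))" if "finite J" "J \<subseteq> {1..n}" for J
    using that by (induction J) (auto simp: convex_on_const assms intro!: convex_on_add)
  then have "convex_on X (\<lambda>x. (1 / real n) * (\<Sum>j=1..n. F x (z j)))"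
    by (intro convex_on_cmul) auto
  then show ?thesis unfolding saa_objective_def[abs_def] .
qed

text \<open>The integrand is measurable only for the trace sigma-algebra on the set of admissible
  values, so the sample has to be viewed in that space. A variable with values in
  \<open>\<Omega> i\<close> has the same preimage for an event and for its trace, so no new events
  arise.\<close>

lemma (in prob_space) indep_vars_restrict_space:
  assumes "indep_vars M' X I" "\<And>i. i \<in> I \<Longrightarrow> X i \<in> space M \<rightarrow> \<Omega> i"
  shows "indep_vars (\<lambda>i. restrict_space (M' i) (\<Omega> i)) X I"
  unfolding indep_vars_def2
proof (intro conjI ballI)
  fix i assume "i \<in> I"
  then show "random_variable (restrict_space (M' i) (\<Omega> i)) (X i)"
    using assms by (intro measurable_restrict_space2) (auto simp: indep_vars_def2)
next
  have "indep_sets (\<lambda>i. {X i -` A \<inter> space M |A. A \<in> sets (M' i)}) I"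
    using assms(1) by (simp add: indep_vars_def2)
  then show "indep_sets (\<lambda>i. {X i -` A \<inter> space M |A. A \<in> sets (restrict_space (M' i) (\<Omega> i))}) I"
  proof (rule indep_sets_mono_sets)
    fix i assume i: "i \<in> I"
    show "{X i -` A \<inter> space M |A. A \<in> sets (restrict_space (M' i) (\<Omega> i))}
        \<subseteq> {X i -` A \<inter> space M |A. A \<in> sets (M' i)}"
    proof clarify
      fix A assume "A \<in> sets (restrict_space (M' i) (\<Omega> i))"
      then obtain B where "B \<in> sets (M' i)" "A = \<Omega> i \<inter> B" by (auto simp: sets_restrict_space)
      moreover from this have "X i -` A \<inter> space M = X i -` B \<inter> space M"
        using assms(2)[OF i] by auto
      ultimately show "\<exists>B. X i -` A \<inter> space M = X i -` B \<inter> space M \<and> B \<in> sets (M' i)" by blast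
    qed
  qed
qed

text \<open>Again a trace and the event it comes from have equal preimages under maps into
  \<open>\<Omega>\<close>, so both restricted laws are read off from the common unrestricted
  one.\<close>

lemma distr_restrict_space_cong:
  assumes "X \<in> measurable M N" "Y \<in> measurable M N" "X \<in> space M \<rightarrow> \<Omega>" "Y \<in> space M \<rightarrow> \<Omega>"
    and eq: "distr M N X = distr M N Y"
  shows "distr M (restrict_space N \<Omega>) X = distr M (restrict_space N \<Omega>) Y"
proof (rule measure_eqI)
  fix A assume "A \<in> sets (distr M (restrict_space N \<Omega>) X)"
  then have A': "A \<in> sets (restrict_space N \<Omega>)" by simp
  then obtain B where B: "B \<in> sets N" "A = \<Omega> \<inter> B" by (auto simp: sets_restrict_space)
  have *: "emeasure (distr M (restrict_space N \<Omega>) Z) A = emeasure (distr M N Z) B"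
    if Z: "Z \<in> measurable M N" "Z \<in> space M \<rightarrow> \<Omega>" for Z
  proof -
    have "Z \<in> measurable M (restrict_space N \<Omega>)" using Z by (intro measurable_restrict_space2)
    moreover have "Z -` A \<inter> space M = Z -` B \<inter> space M" using Z(2) B(2) by auto
    ultimately show ?thesis using Z(1) A' B(1) by (simp add: emeasure_distr)
  qed
  show "emeasure (distr M (restrict_space N \<Omega>) X) A = emeasure (distr M (restrict_space N \<Omega>) Y) A"
    using *[OF assms(1,3)] *[OF assms(2,4)] eq by simp
qed simp

lemma block_subset:
  fixes i m n :: nat
  assumes "i \<in> {1..m}"
  shows "(\<lambda>j. (i - 1) * n + j) ` {1..n} \<subseteq> {1..m * n}"
proof -
  have "(i - 1) * n + j \<le> m * n" if "j \<le> n" for j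
  proof -
    have "(i - 1) * n + j \<le> (i - 1) * n + n" using that by (intro add_left_mono) simp
    also have "\<dots> = i * n" using assms by (cases i) auto
    also have "\<dots> \<le> m * n" using assms by simp
    finally show ?thesis .
  qed
  then show ?thesis by (intro image_subsetI) auto
qed

lemma disjoint_blocks:
  fixes m n :: nat
  shows "disjoint_family_on (\<lambda>i. (\<lambda>j. (i - 1) * n + j) ` {1..n}) {1..m}"
proof -
  have "(i - 1) * n + j < (i' - 1) * n + j'" if "i \<in> {1..m}" "i < i'" "j \<in> {1..n}" "j' \<in> {1..n}" for i i' j j' :: nat
  proof -
    have "(i - 1) * n + j \<le> (i - 1) * n + n" using that by (intro add_left_mono) simp
    also have "\<dots> = i * n" using that(1) by (cases i) auto
    also have "\<dots> \<le> (i' - 1) * n" using that(2) by (intro mult_right_mono) auto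
    finally show ?thesis using that(4) by simp
  qed
  then show ?thesis
    unfolding disjoint_family_on_def by (fastforce simp: neq_iff)
qed

text \<open>Diagonal terms use \<open>Y i\<close> squared at most b times \<open>Y i\<close>,
  keeping them linear in e; off the diagonal the expectation factors. The linear part is the one
  that later decays like 1/m.\<close>

lemma (in prob_space) second_moment_indep_sum_le:
  fixes Y :: "'i \<Rightarrow> 'a \<Rightarrow> real"
  assumes I: "finite I" and indep: "indep_vars (\<lambda>_. borel) Y I"
    and Y: "\<And>i \<omega>. i \<in> I \<Longrightarrow> \<omega> \<in> space M \<Longrightarrow> 0 \<le> Y i \<omega> \<and> Y i \<omega> \<le> b"
    and e: "\<And>i. i \<in> I \<Longrightarrow> expectation (Y i) \<le> e" and "0 \<le> b" "0 \<le> e"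
  shows "expectation (\<lambda>\<omega>. (\<Sum>i\<in>I. Y i \<omega>)\<^sup>2) \<le> real (card I) * (b * e) + (real (card I))\<^sup>2 * e\<^sup>2"
proof -
  have meas: "Y i \<in> borel_measurable M" if "i \<in> I" for i
    using indep that by (auto simp: indep_vars_def)
  have int: "integrable M (Y i)" if "i \<in> I" for i
    using meas[OF that] Y[OF that] by (intro integrable_const_bound[of _ b]) auto
  have int2: "integrable M (\<lambda>\<omega>. Y i \<omega> * Y j \<omega>)" if "i \<in> I" "j \<in> I" for i j
    using meas[OF that(1)] meas[OF that(2)] Y[OF that(1)] Y[OF that(2)] \<open>0 \<le> b\<close>
    by (intro integrable_const_bound[of _ "b * b"]) (auto intro!: AE_I2 mult_mono simp: abs_mult)
  \<comment> \<open>The summand e^2 is granted on the diagonal as well, so that the double sum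
    becomes the full square of the cardinality times e^2.\<close>
  have pair: "expectation (\<lambda>\<omega>. Y i \<omega> * Y j \<omega>) \<le> (if j = i then b * e else 0) + e\<^sup>2"
    if i: "i \<in> I" and j: "j \<in> I" for i j
  proof (cases "j = i")
    case True
    have "expectation (\<lambda>\<omega>. Y i \<omega> * Y i \<omega>) \<le> expectation (\<lambda>\<omega>. b * Y i \<omega>)"
      using Y[OF i] int[OF i] int2[OF i i] by (intro integral_mono mult_right_mono) auto
    also have "\<dots> \<le> b * e" using e[OF i] \<open>0 \<le> b\<close> by (simp add: mult_left_mono)
    finally show ?thesis using True by (simp add: add_increasing2)
  next
    case False
    have "indep_vars (\<lambda>_. borel) Y {i, j}"
      using i j by (intro indep_vars_subset[OF indep]) auto
    then have "expectation (\<lambda>\<omega>. \<Prod>k\<in>{i, j}. Y k \<omega>) = (\<Prod>k\<in>{i, j}. expectation (Y k))"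
      using i j int by (intro indep_vars_lebesgue_integral) auto
    then have "expectation (\<lambda>\<omega>. Y i \<omega> * Y j \<omega>) = expectation (Y i) * expectation (Y j)"
      using False by auto
    also have "\<dots> \<le> e * e"
    proof (rule mult_mono)
      show "0 \<le> expectation (Y j)" using Y[OF j] by (intro integral_nonneg_AE) auto
    qed (use e i j \<open>0 \<le> e\<close> in auto)
    finally show ?thesis using False by (simp add: power2_eq_square)
  qed
  have "expectation (\<lambda>\<omega>. (\<Sum>i\<in>I. Y i \<omega>)\<^sup>2) = (\<Sum>i\<in>I. \<Sum>j\<in>I. expectation (\<lambda>\<omega>. Y i \<omega> * Y j \<omega>))"
    using int2 by (simp add: power2_eq_square sum_product)
  also have "\<dots> \<le> (\<Sum>i\<in>I. \<Sum>j\<in>I. (if j = i then b * e else 0) + e\<^sup>2)"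
    by (intro sum_mono pair)
  also have "\<dots> = real (card I) * (b * e) + (real (card I))\<^sup>2 * e\<^sup>2"
    using I by (simp add: sum.distrib power2_eq_square algebra_simps)
  finally show ?thesis .
qed

theorem theorem3p1:
  fixes M :: "'w measure"
    and \<xi> :: "'w \<Rightarrow> real ^ 'd"
    and \<xi>s :: "nat \<Rightarrow> 'w \<Rightarrow> real ^ 'd"
    and \<Xi> :: "(real ^ 'd) set"
    and X C :: "(real ^ 'p) set"
    and F :: "real ^ 'p \<Rightarrow> real ^ 'd \<Rightarrow> real"
    and D L\<^sub>F M\<^sub>F \<gamma> l \<rho> :: real
    and m n :: nat
    and xsel :: "(nat \<Rightarrow> real ^ 'd) \<Rightarrow> real ^ 'p"
  defines "\<theta> \<equiv> opt_value (true_objective M \<xi> F) X"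
    and "\<Theta> \<equiv> (\<lambda>\<omega>. compromise_value F X xsel \<rho> m n (\<lambda>k. \<xi>s k \<omega>))"
    and "R \<equiv> rademacher_average F X \<Xi> n"
    and "N\<^sub>F \<equiv> N_const L\<^sub>F M\<^sub>F D \<gamma> CARD('p) l"
  assumes prob: "prob_space M"
    and \<xi>_meas: "\<xi> \<in> borel_measurable M"
    and \<xi>_range: "\<And>\<omega>. \<omega> \<in> space M \<Longrightarrow> \<xi> \<omega> \<in> \<Xi>"
    and sample_indep: "prob_space.indep_vars M (\<lambda>_. borel) \<xi>s {1..m * n}"
    and sample_distr: "\<And>k. k \<in> {1..m * n} \<Longrightarrow> distr M borel (\<xi>s k) = distr M borel \<xi>"
    and sample_range: "\<And>k \<omega>. k \<in> {1..m * n} \<Longrightarrow> \<omega> \<in> space M \<Longrightarrow> \<xi>s k \<omega> \<in> \<Xi>"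
    and X: "X \<noteq> {}" "compact X" "convex X"
    and cube: "is_cube D C" "X \<subseteq> C"
    and F_cont: "\<And>z. z \<in> \<Xi> \<Longrightarrow> continuous_on X (\<lambda>x. F x z)"
    and F_meas: "\<And>x. x \<in> X \<Longrightarrow> F x \<in> borel_measurable (restrict_space borel \<Xi>)"
    and \<gamma>: "0 < \<gamma>" "\<gamma> \<le> 1"
    and L_nonneg: "0 \<le> L\<^sub>F"
    and F_Hoelder: "\<And>x y z. x \<in> X \<Longrightarrow> y \<in> X \<Longrightarrow> z \<in> \<Xi> \<Longrightarrow>
                      \<bar>F x z - F y z\<bar> \<le> L\<^sub>F * norm (x - y) powr \<gamma>"
    and M_pos: "0 < M\<^sub>F"
    and F_bound: "(SUP (x, z) \<in> X \<times> \<Xi>. ereal \<bar>F x z\<bar>) < ereal M\<^sub>F"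
    and F_convex: "\<And>z. z \<in> \<Xi> \<Longrightarrow> convex_on X (\<lambda>x. F x z)"
    and params: "0 < l" "l < 1 / 2" "0 < m" "0 < n" "0 < \<rho>"
    and selection: "\<And>i \<omega>. i \<in> {1..m} \<Longrightarrow> \<omega> \<in> space M \<Longrightarrow>
          xsel (replication n (\<lambda>k. \<xi>s k \<omega>) i)
            \<in> argmin_set (saa_objective F n (replication n (\<lambda>k. \<xi>s k \<omega>) i)) X"
    and selection_meas: "\<And>i. i \<in> {1..m} \<Longrightarrow>
          (\<lambda>\<omega>. xsel (replication n (\<lambda>k. \<xi>s k \<omega>) i)) \<in> borel_measurable M"
    and value_meas: "\<Theta> \<in> borel_measurable M"
  shows "prob_space.expectation M (\<lambda>\<omega>. \<bar>\<Theta> \<omega> - \<theta>\<bar>) \<le> (6 * real m - 4) / real m * R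
       \<and> (6 * real m - 4) / real m * R \<le> (6 * real m - 4) / (real m * real n powr l) * N\<^sub>F
       \<and> prob_space.variance M (\<lambda>\<omega>. \<bar>\<Theta> \<omega> - \<theta>\<bar>)
           \<le> 36 * M\<^sub>F * N\<^sub>F / (real m * real n powr l) + 36 * N\<^sub>F\<^sup>2 / real n powr (2 * l)"
proof -
  interpret prob_space M by (rule prob)
  define N where "N = restrict_space (borel :: (real ^ 'd) measure) \<Xi>"
  \<comment> \<open>The law is taken on the restricted space, so that its underlying set is
    \<open>\<Xi>\<close> itself and the supremum in \<open>R\<close> ranges over samples from the
    space of \<open>\<mu>\<close>.\<close>
  define \<mu> where "\<mu> = distr M N \<xi>"
  define blk where "blk i j = (i - 1) * n + j" for i j
  define \<Delta> where "\<Delta> i \<omega> = deviation \<mu> F X n (replication n (\<lambda>k. \<xi>s k \<omega>) i)" for i \<omega>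
  let ?I = "{1..m * n}"
  have m1: "1 \<le> real m" using params(3) by simp
  have space_N: "space N = \<Xi>" by (simp add: N_def space_restrict_space)
  have sets_\<mu>: "sets \<mu> = sets N" by (simp add: \<mu>_def)
  have space_\<mu>: "space \<mu> = \<Xi>" by (simp add: \<mu>_def space_N)
  have \<xi>_N: "\<xi> \<in> measurable M N"
    unfolding N_def using \<xi>_meas \<xi>_range by (intro measurable_restrict_space2) auto
  have bound: "\<bar>F x z\<bar> \<le> M\<^sub>F" if "x \<in> X" "z \<in> \<Xi>" for x z
  proof -
    have "ereal \<bar>F x z\<bar> \<le> (SUP (x, z) \<in> X \<times> \<Xi>. ereal \<bar>F x z\<bar>)"
      using that by (intro SUP_upper2[of "(x, z)"]) auto
    then have "ereal \<bar>F x z\<bar> < ereal M\<^sub>F" using F_bound by (rule le_less_trans)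
    then show ?thesis by simp
  qed
  interpret C: bounded_caratheodory \<mu> F X M\<^sub>F n
  proof (intro bounded_caratheodory.intro bounded_caratheodory_axioms.intro)
    show "prob_space \<mu>" unfolding \<mu>_def by (rule prob_space_distr[OF \<xi>_N])
    show "F x \<in> borel_measurable \<mu>" if "x \<in> X" for x
      using F_meas[OF that] unfolding measurable_cong_sets[OF sets_\<mu> refl] N_def .
  qed (use X params F_cont bound in \<open>auto simp: space_\<mu>\<close>)
  have mean: "true_objective M \<xi> F x = (\<integral>y. F x y \<partial>\<mu>)" if "x \<in> X" for x
    unfolding true_objective_def \<mu>_def
    using F_meas[OF that] by (intro integral_distr[symmetric, OF \<xi>_N]) (simp add: N_def)
  have "continuous_on X (true_objective M \<xi> F)"
    using C.continuous_on_mean by (rule continuous_on_eq) (simp add: mean)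
  then obtain x\<^sub>0 where x\<^sub>0: "x\<^sub>0 \<in> X" "true_objective M \<xi> F x\<^sub>0 = \<theta>"
    "\<And>y. y \<in> X \<Longrightarrow> true_objective M \<xi> F x\<^sub>0 \<le> true_objective M \<xi> F y"
    using opt_value_attained[OF X(2,1)] unfolding \<theta>_def by blast
  have blk_I: "blk i j \<in> ?I" if "i \<in> {1..m}" "j \<in> {1..n}" for i j
    using block_subset[OF that(1), of n] that(2) by (auto simp: blk_def)
  have repl: "replication n (\<lambda>k. \<xi>s k \<omega>) i = (\<lambda>j\<in>{1..n}. \<xi>s (blk i j) \<omega>)" for i \<omega>
    by (simp add: replication_def blk_def)
  have sample_\<Xi>: "replication n (\<lambda>k. \<xi>s k \<omega>) i j \<in> \<Xi>"
    if "i \<in> {1..m}" "\<omega> \<in> space M" "j \<in> {1..n}" for i j \<omega>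
    unfolding repl using sample_range[OF blk_I[OF that(1,3)] that(2)] that(3) by simp
  then have sample_\<mu>: "replication n (\<lambda>k. \<xi>s k \<omega>) i \<in> {1..n} \<rightarrow> space \<mu>"
    if "i \<in> {1..m}" "\<omega> \<in> space M" for i \<omega>
    using that by (auto simp: space_\<mu>)
  have \<Delta>_bounds: "0 \<le> \<Delta> i \<omega>" "\<Delta> i \<omega> \<le> 2 * M\<^sub>F" if "i \<in> {1..m}" "\<omega> \<in> space M" for i \<omega>
    unfolding \<Delta>_def using C.deviation_bounds[OF sample_\<mu>[OF that]] by auto
  have indep_N: "indep_vars (\<lambda>_. N) \<xi>s ?I"
    unfolding N_def using sample_range by (intro indep_vars_restrict_space sample_indep) auto
  have \<xi>s_N: "\<xi>s k \<in> measurable M N" if "k \<in> ?I" for k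
    using indep_N that by (auto simp: indep_vars_def2)
  have distr_\<xi>s: "distr M N (\<xi>s k) = \<mu>" if k: "k \<in> ?I" for k
    unfolding \<mu>_def N_def
  proof (rule distr_restrict_space_cong)
    show "\<xi>s k \<in> borel_measurable M" using sample_indep k by (auto simp: indep_vars_def2)
  qed (use k sample_range \<xi>_range \<xi>_meas sample_distr in auto)
  \<comment> \<open>Characterizing independence by a product law requires a nonempty index
    set.\<close>
  have I_ne: "?I \<noteq> {}" using params(3,4) by (simp add: Suc_le_eq One_nat_def)
  have sets_PiM_\<mu>: "sets (PiM J (\<lambda>_. \<mu>)) = sets (PiM J (\<lambda>_. N))" for J :: "nat set"
    by (intro sets_PiM_cong refl sets_\<mu>)
  have "PiM ?I (\<lambda>k. distr M N (\<xi>s k)) = PiM ?I (\<lambda>_. \<mu>)"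
    by (intro PiM_cong refl distr_\<xi>s)
  then have sample_law: "distr M (PiM ?I (\<lambda>_. N)) (\<lambda>\<omega>. \<lambda>k\<in>?I. \<xi>s k \<omega>) = PiM ?I (\<lambda>_. \<mu>)"
    using indep_vars_iff_distr_eq_PiM'[OF I_ne, where M' = "\<lambda>_. N" and X = \<xi>s] \<xi>s_N indep_N by simp
  \<comment> \<open>The carrier J is left open on purpose: the whole index set gives the law of one
    deviation, while the block alone shows that different deviations depend on disjoint parts of the
    sample.\<close>
  have dev_block: "(\<lambda>w. deviation \<mu> F X n (\<lambda>j\<in>{1..n}. w (blk i j))) \<in> borel_measurable (PiM J (\<lambda>_. N))"
    if "blk i ` {1..n} \<subseteq> J" for i J
    unfolding measurable_cong_sets[OF sets_PiM_\<mu>[symmetric] refl] using that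
    by (intro measurable_compose[OF _ C.measurable_deviation] measurable_restrict measurable_component_singleton) auto
  have \<Delta>_eq: "\<Delta> i \<omega> = deviation \<mu> F X n (\<lambda>j\<in>{1..n}. (\<lambda>k\<in>J. \<xi>s k \<omega>) (blk i j))"
    if "blk i ` {1..n} \<subseteq> J" for i \<omega> J
    unfolding \<Delta>_def repl using that by (intro arg_cong[where f = "deviation \<mu> F X n"] restrict_ext) (auto simp: image_subset_iff)
  have E_\<Delta>: "expectation (\<Delta> i) \<le> 2 * R" if i: "i \<in> {1..m}" for i
  proof -
    have sub: "blk i ` {1..n} \<subseteq> ?I" using blk_I[OF i] by auto
    have m: "(\<lambda>\<omega>. \<lambda>k\<in>?I. \<xi>s k \<omega>) \<in> measurable M (PiM ?I (\<lambda>_. N))"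
      using \<xi>s_N by (intro measurable_restrict)
    have "expectation (\<Delta> i) = (\<integral>w. deviation \<mu> F X n (\<lambda>j\<in>{1..n}. w (blk i j)) \<partial>PiM ?I (\<lambda>_. \<mu>))"
      unfolding \<Delta>_eq[OF sub, abs_def] sample_law[symmetric] by (rule integral_distr[OF m dev_block[OF sub], symmetric])
    also have "\<dots> = (\<integral>z. deviation \<mu> F X n z \<partial>PiM {1..n} (\<lambda>_. \<mu>))"
      using sub by (intro integral_PiM_reindex C.measurable_deviation C.prob_space_axioms)
        (auto simp: blk_def inj_on_def)
    also have "\<dots> \<le> 2 * R"
      using C.expectation_deviation_le by (simp add: space_\<mu> R_def)
    finally show ?thesis .
  qed
  have indep_\<Delta>: "indep_vars (\<lambda>_. borel) \<Delta> {1..m}"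
  proof -
    have "indep_vars (\<lambda>i. PiM (blk i ` {1..n}) (\<lambda>_. N)) (\<lambda>i \<omega>. \<lambda>k\<in>blk i ` {1..n}. \<xi>s k \<omega>) {1..m}"
    proof (rule indep_vars_restrict[OF indep_N])
      show "disjoint_family_on (\<lambda>i. blk i ` {1..n}) {1..m}"
        using disjoint_blocks by (simp add: blk_def[abs_def])
    qed (use blk_I in auto)
    then have "indep_vars (\<lambda>_. borel)
        (\<lambda>i \<omega>. deviation \<mu> F X n (\<lambda>j\<in>{1..n}. (\<lambda>k\<in>blk i ` {1..n}. \<xi>s k \<omega>) (blk i j))) {1..m}"
      by (rule indep_vars_compose2) (rule dev_block[OF order.refl])
    then show ?thesis
      using \<Delta>_eq[OF order.refl] by presburger
  qed
  have \<Delta>_meas: "\<Delta> i \<in> borel_measurable M" if "i \<in> {1..m}" for i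
    using indep_\<Delta> that by (auto simp: indep_vars_def2)
  have \<Delta>_int: "integrable M (\<Delta> i)" if "i \<in> {1..m}" for i
    using \<Delta>_bounds[OF that] \<Delta>_meas[OF that] by (intro integrable_const_bound[of _ "2 * M\<^sub>F"]) auto
  define S where "S \<omega> = (\<Sum>i=1..m. \<Delta> i \<omega>)" for \<omega>
  have S_meas: "S \<in> borel_measurable M"
    unfolding S_def using \<Delta>_meas by (intro borel_measurable_sum)
  have S_bounds: "0 \<le> S \<omega>" "S \<omega> \<le> real m * (2 * M\<^sub>F)" if "\<omega> \<in> space M" for \<omega>
    unfolding S_def using \<Delta>_bounds[OF _ that] sum_bounded_above[of "{1..m}" "\<lambda>i. \<Delta> i \<omega>" "2 * M\<^sub>F"]
    by (auto intro!: sum_nonneg)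
  have S_int: "integrable M S"
    using S_bounds S_meas by (intro integrable_const_bound[of _ "real m * (2 * M\<^sub>F)"]) auto
  have S2_int: "integrable M (\<lambda>\<omega>. (S \<omega>)\<^sup>2)"
    using S_bounds S_meas by (intro integrable_const_bound[of _ "(real m * (2 * M\<^sub>F))\<^sup>2"]) (auto intro!: power_mono)
  define c where "c = (3 * real m - 2) / (real m)\<^sup>2"
  have c: "0 \<le> c" using m1 by (simp add: c_def)
  have pointwise: "\<bar>\<Theta> \<omega> - \<theta>\<bar> \<le> c * S \<omega>" if \<omega>: "\<omega> \<in> space M" for \<omega>
  proof -
    let ?z = "\<lambda>i. replication n (\<lambda>k. \<xi>s k \<omega>) i"
    have sel: "xsel (?z i) \<in> X" "\<And>y. y \<in> X \<Longrightarrow> saa_objective F n (?z i) (xsel (?z i)) \<le> saa_objective F n (?z i) y"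
      if "i \<in> {1..m}" for i
      using selection[OF that \<omega>] by (auto simp: argmin_set_def is_arg_min_def not_less)
    have conv: "convex_on X (saa_objective F n (?z i))" if "i \<in> {1..m}" for i
      using sample_\<Xi>[OF that \<omega>] F_convex X(3) by (intro convex_on_saa_objective) auto
    have dev: "\<bar>saa_objective F n (?z i) x - true_objective M \<xi> F x\<bar> \<le> \<Delta> i \<omega>"
      if "i \<in> {1..m}" "x \<in> X" for i x
      unfolding \<Delta>_def mean[OF that(2)]
      by (rule C.saa_deviation_le_deviation[OF that(2) sample_\<mu>[OF that(1) \<omega>]])
    show ?thesis
      using compromise_value_deviation_le[OF params(3) less_imp_le[OF params(5)] x\<^sub>0(1,3) conv sel dev]
      unfolding \<Theta>_def compromise_value_def compromise_objective_def[abs_def] x\<^sub>0(2) c_def S_def .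
  qed
  \<comment> \<open>Nonnegativity comes for free from the expectation bound of one replication. It
    allows the bound on \<open>R\<close> to be squared in the variance estimate.\<close>
  have R0: "0 \<le> R"
  proof -
    have "0 \<le> expectation (\<Delta> 1)"
      using \<Delta>_bounds(1)[of 1] params(3) by (intro integral_nonneg_AE) auto
    then show ?thesis using E_\<Delta>[of 1] params(3) by simp
  qed
  \<comment> \<open>Measurability of \<open>\<Theta>\<close> is assumed, so its integrability and
    that of its square follow by comparison with multiples of \<open>S\<close> and of its
    square.\<close>
  have dominated: "integrable M g"
    if "g \<in> borel_measurable M" "integrable M h" "\<And>\<omega>. \<omega> \<in> space M \<Longrightarrow> 0 \<le> g \<omega> \<and> g \<omega> \<le> h \<omega>" for g h :: "'w \<Rightarrow> real"
    using that by (intro Bochner_Integration.integrable_bound[OF that(2,1)] AE_I2) force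
  have \<Theta>_int: "integrable M (\<lambda>\<omega>. \<bar>\<Theta> \<omega> - \<theta>\<bar>)"
    by (rule dominated[of _ "\<lambda>\<omega>. c * S \<omega>"]) (use pointwise S_int value_meas in simp_all)
  have pointwise2: "\<bar>\<Theta> \<omega> - \<theta>\<bar>\<^sup>2 \<le> c\<^sup>2 * (S \<omega>)\<^sup>2" if "\<omega> \<in> space M" for \<omega>
    using power_mono[OF pointwise[OF that], of 2] by (simp add: power_mult_distrib)
  have \<Theta>2_int: "integrable M (\<lambda>\<omega>. \<bar>\<Theta> \<omega> - \<theta>\<bar>\<^sup>2)"
    by (rule dominated[of _ "\<lambda>\<omega>. c\<^sup>2 * (S \<omega>)\<^sup>2"]) (use pointwise2 S2_int value_meas in simp_all)
  have E_S: "expectation S \<le> real m * (2 * R)"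
  proof -
    have "expectation S = (\<Sum>i=1..m. expectation (\<Delta> i))"
      unfolding S_def using \<Delta>_int by (intro Bochner_Integration.integral_sum)
    also have "\<dots> \<le> (\<Sum>i=1..m. 2 * R)" by (intro sum_mono E_\<Delta>)
    finally show ?thesis by simp
  qed
  have "\<Xi> \<noteq> {}" using not_empty \<xi>_range by auto
  then have R_le: "R \<le> N\<^sub>F / real n powr l"
    unfolding R_def N\<^sub>F_def using X compact_imp_closed cube \<gamma> L_nonneg F_Hoelder bound M_pos params
    by (intro rademacher_average_le_N_const) auto
  have part1: "expectation (\<lambda>\<omega>. \<bar>\<Theta> \<omega> - \<theta>\<bar>) \<le> (6 * real m - 4) / real m * R"
  proof -
    have "expectation (\<lambda>\<omega>. \<bar>\<Theta> \<omega> - \<theta>\<bar>) \<le> expectation (\<lambda>\<omega>. c * S \<omega>)"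
      using pointwise \<Theta>_int S_int by (intro integral_mono) auto
    also have "\<dots> \<le> c * (real m * (2 * R))" using E_S c by (simp add: mult_left_mono)
    also have "\<dots> = (6 * real m - 4) / real m * R"
      using m1 by (simp add: c_def field_simps power2_eq_square)
    finally show ?thesis .
  qed
  have part2: "(6 * real m - 4) / real m * R \<le> (6 * real m - 4) / (real m * real n powr l) * N\<^sub>F"
  proof -
    have "(6 * real m - 4) / real m * R \<le> (6 * real m - 4) / real m * (N\<^sub>F / real n powr l)"
      using R_le m1 by (intro mult_left_mono) auto
    then show ?thesis by simp
  qed
  have part3: "variance (\<lambda>\<omega>. \<bar>\<Theta> \<omega> - \<theta>\<bar>)
      \<le> 36 * M\<^sub>F * N\<^sub>F / (real m * real n powr l) + 36 * N\<^sub>F\<^sup>2 / real n powr (2 * l)"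
  proof -
    \<comment> \<open>The squared mean is discarded and only the second moment is estimated.\<close>
    have "variance (\<lambda>\<omega>. \<bar>\<Theta> \<omega> - \<theta>\<bar>) \<le> expectation (\<lambda>\<omega>. \<bar>\<Theta> \<omega> - \<theta>\<bar>\<^sup>2)"
      unfolding variance_eq[OF \<Theta>_int \<Theta>2_int] by simp
    also have "\<dots> \<le> expectation (\<lambda>\<omega>. c\<^sup>2 * (S \<omega>)\<^sup>2)"
      using pointwise2 \<Theta>2_int S2_int by (intro integral_mono) auto
    also have "\<dots> = c\<^sup>2 * expectation (\<lambda>\<omega>. (S \<omega>)\<^sup>2)" by simp
    \<comment> \<open>The coefficient (3m - 2)/m^2 is relaxed to 3/m here, which gives the clean
      constant 36 = 9 * 4; the expectation bound keeps the sharper value.\<close>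
    also have "\<dots> \<le> (3 / real m)\<^sup>2 * expectation (\<lambda>\<omega>. (S \<omega>)\<^sup>2)"
    proof (intro mult_right_mono power_mono c)
      show "c \<le> 3 / real m" using m1 by (simp add: c_def field_simps power2_eq_square)
    qed auto
    also have "\<dots> \<le> (3 / real m)\<^sup>2 * (real m * (2 * M\<^sub>F * (2 * R)) + (real m)\<^sup>2 * (2 * R)\<^sup>2)"
      using second_moment_indep_sum_le[OF _ indep_\<Delta> _ E_\<Delta>, of "2 * M\<^sub>F"] \<Delta>_bounds M_pos R0
      unfolding S_def by (intro mult_left_mono) auto
    also have "\<dots> = 36 * M\<^sub>F * R / real m + 36 * R\<^sup>2"
      using m1 by (simp add: field_simps power2_eq_square)
    also have "\<dots> \<le> 36 * M\<^sub>F * (N\<^sub>F / real n powr l) / real m + 36 * (N\<^sub>F / real n powr l)\<^sup>2"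
      using R_le R0 M_pos by (intro add_mono divide_right_mono mult_left_mono power_mono) auto
    also have "\<dots> = 36 * M\<^sub>F * N\<^sub>F / (real m * real n powr l) + 36 * N\<^sub>F\<^sup>2 / real n powr (2 * l)"
    proof -
      have "real n powr (2 * l) = (real n powr l)\<^sup>2"
        by (simp add: power2_eq_square powr_add[symmetric])
      then show ?thesis by (simp add: power_divide)
    qed
    finally show ?thesis .
  qed
  show ?thesis using part1 part2 part3 by blast
qed

end
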